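(* Let a data set $\mathfrak D_{\rm simple}$ be given, consisting of points $z_1,\dots,z_N\in\Pi_+$ and $w_1,\dots,w_{N'}\in\Pi_+$, vectors $x_i\in\mathbb C^{1\times p}$, $y_i\in\mathbb C^{1\times m}$ ($1\le i\le N$), $u_j\in\mathbb C^{m\times 1}$, $v_j\in\mathbb C^{p\times 1}$ ($1\le j\le N'$), and numbers $\rho_{ij}\in\mathbb C$ for those pairs $(i,j)$ with $z_i=w_j=:\xi_{ij}$. Then there exists a function $S\in\mathcal S^{p\times m}(\Pi_+)$ satisfying $$x_iS(z_i)=y_i\ (1\le i\le N),\qquad S(w_j)u_j=v_j\ (1\le j\le N'),\qquad x_iS'(\xi_{ij})u_j=\rho_{ij}\ \text{ for all }(i,j)\text{ with } z_i=w_j=:\xi_{ij},$$ if and only if the associated Pick matrix $$P_{\mathfrak D_{\rm simple}}=\begin{bmatrix}P_{11}&P_{12}\\ P_{12}^*&P_{22}\end{bmatrix}$$ is positive semidefinite, where $$[P_{11}]_{ij}=\frac{x_ix_j^*-y_iy_j^*}{z_i+\overline z_j}\ (1\le i,j\le N),\qquad [P_{22}]_{ij}=\frac{u_i^*u_j-v_i^*v_j}{\overline w_i+w_j}\ (1\le i,j\le N'),$$ $$[P_{12}]_{ij}=\begin{cases}\dfrac{x_iv_j-y_iu_j}{w_j-z_i}& \text{if } z_i\neq w_j,\\[2mm] \rho_{ij}& \text{if } z_i=w_j,\end{cases}\qquad (1\le i\le N,\ 1\le j\le N').$$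
   Context: $\Pi_+=\{z\in\mathbb C:\operatorname{Re}z>0\}$ is the open right half plane. $\mathcal S^{p\times m}(\Pi_+)$ is the Schur class of analytic functions $S:\Pi_+\to\mathbb C^{p\times m}$ with $\|S(\lambda)\|\le1$ (operator norm) for all $\lambda\in\Pi_+$. $S'$ denotes the derivative of $S$, and $A^*$ denotes the conjugate transpose of a matrix $A$.
   Formalization: The formal theorem adds the compatibility condition x_i v_j = y_i u_j whenever z_i = w_j; without it the "if" direction fails, e.g. p=m=N=N'=1, z=w=1, x=u=1, y=0, v=1/2, ρ=0, where the Pick matrix is positive definite but no S exists. *)

theory Defs
  imports "HOL-Complex_Analysis.Complex_Analysis" "Jordan_Normal_Form.Schur_Decomposition"
begin

no_notation Matrix.vec_index (infixl \<open>$\<close> 100)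

text \<open>
  The sizes \<open>p\<close>, \<open>m\<close> are the cardinalities of the finite index types \<open>'p\<close>, \<open>'m\<close>; row and column
  vectors are both of type \<open>complex ^ _\<close>. The numbers \<open>N\<close>, \<open>N'\<close> of interpolation points are natural
  numbers (possibly 0), so the points are indexed from 0 and the Pick matrix is a matrix
  with explicit carrier.
\<close>

definition right_half_plane :: "complex set" where
  "right_half_plane = {z. 0 < Re z}"

definition mat_deriv :: "(complex \<Rightarrow> complex ^ 'm ^ 'p) \<Rightarrow> complex \<Rightarrow> complex ^ 'm ^ 'p" where
  "mat_deriv S \<xi> = (\<chi> i j. deriv (\<lambda>z. S z $ i $ j) \<xi>)"

text \<open>
  The norm on \<open>complex ^ 'n\<close> is the Euclidean one, so \<open>onorm\<close> is the operator norm of a matrix.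
\<close>

definition schur_class :: "(complex \<Rightarrow> complex ^ 'm ^ 'p) set" where
  "schur_class = {S. (\<forall>i j. (\<lambda>z. S z $ i $ j) holomorphic_on right_half_plane) \<and>
                     (\<forall>z\<in>right_half_plane. onorm ((*v) (S z)) \<le> 1)}"

text \<open>
  The library's \<open>scalar_product\<close> does not conjugate: it is the product of a row and a column.
  Hence \<open>x y\<^sup>*\<close> and \<open>u\<^sup>* v\<close> are \<open>scalar_product x (cnj_vec y)\<close> and \<open>scalar_product (cnj_vec u) v\<close>.
\<close>

definition cnj_vec :: "complex ^ 'n \<Rightarrow> complex ^ 'n" where
  "cnj_vec x = (\<chi> k. cnj (x $ k))"

definition positive_semidefinite :: "complex Matrix.mat \<Rightarrow> bool" where
  "positive_semidefinite A \<longleftrightarrow> square_mat A \<and> mat_adjoint A = A \<and>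
     (\<forall>c\<in>carrier_vec (dim_row A). 0 \<le> Re ((A *\<^sub>v c) \<bullet>c c))"

definition pick_matrix ::
  "nat \<Rightarrow> nat \<Rightarrow> (nat \<Rightarrow> complex) \<Rightarrow> (nat \<Rightarrow> complex) \<Rightarrow>
   (nat \<Rightarrow> complex ^ 'p) \<Rightarrow> (nat \<Rightarrow> complex ^ 'm) \<Rightarrow>
   (nat \<Rightarrow> complex ^ 'm) \<Rightarrow> (nat \<Rightarrow> complex ^ 'p) \<Rightarrow>
   (nat \<Rightarrow> nat \<Rightarrow> complex) \<Rightarrow> complex Matrix.mat" where
  "pick_matrix N N' z w x y u v \<rho> =
    (let P11 = Matrix.mat N N (\<lambda>(i, j).
           (scalar_product (x i) (cnj_vec (x j)) - scalar_product (y i) (cnj_vec (y j))) / (z i + cnj (z j)));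
         P12 = Matrix.mat N N' (\<lambda>(i, j).
           if z i \<noteq> w j then (scalar_product (x i) (v j) - scalar_product (y i) (u j)) / (w j - z i)
           else \<rho> i j);
         P22 = Matrix.mat N' N' (\<lambda>(i, j).
           (scalar_product (cnj_vec (u i)) (u j) - scalar_product (cnj_vec (v i)) (v j)) / (cnj (w i) + w j))
     in four_block_mat P11 P12 (mat_adjoint P12) P22)"

end

theory Submission
  imports Defs
begin

no_notation fps_nth (infixl \<open>$\<close> 75)

text \<open>
  Both kinds of tangential data become one list of triples \<open>(p, e, f)\<close>: a left condition
  \<open>x S(z) = y\<close> is \<open>(z, x\<^sup>*, y\<^sup>*)\<close> and a right condition \<open>S(w) u = v\<close> is \<open>(w, -v, -u)\<close>. With
  \<open>\<tau> = cnj z\<close> on the left and \<open>\<tau> = -w\<close> on the right, the Pick matrix solves the single Lyapunov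
  equation \<open>(cnj \<tau>\<^sub>k + \<tau>\<^sub>l) P\<^sub>k\<^sub>l = e\<^sub>k\<^sup>* e\<^sub>l - f\<^sub>k\<^sup>* f\<^sub>l\<close>.

  Sufficiency: factor \<open>P\<close> as a Gram matrix of vectors \<open>g\<^sub>k\<close>. By the Lyapunov equation the vectors
  \<open>((\<tau>\<^sub>k + 1/2) cnj g\<^sub>k, f\<^sub>k)\<close> and \<open>((\<tau>\<^sub>k - 1/2) cnj g\<^sub>k, e\<^sub>k)\<close> have equal Gram matrices, so a partial
  isometry \<open>U\<close> maps the former to the latter. Its transfer function, precomposed with the Cayley
  transform \<open>(z - 1/2) / (z + 1/2)\<close>, is the interpolant; no nondegeneracy of \<open>P\<close> is needed.

  Necessity: on a disc, contractivity of \<open>S\<close> makes \<open>\<parallel>a\<parallel>\<^sup>2 - 2 Re \<langle>a, S b\<rangle> + \<parallel>b\<parallel>\<^sup>2\<close> nonnegative on the boundary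
  circle, where \<open>a\<close> and \<open>b\<close> are combinations of the \<open>e\<^sub>k\<close> and the \<open>f\<^sub>k\<close> with Cauchy kernels as
  coefficients; by Cauchy's formula its mean is the quadratic form of the Pick matrix of the disc.
  Discs exhausting the half plane give the Pick matrix of the half plane in the limit.
\<close>

section \<open>Partial isometries and Gram matrices\<close>

text \<open>Vectors are plain functions with an explicit index set, because the state space has
  dimension \<open>n\<close>, a number and not a type; direct sums with \<open>complex ^ 'm\<close>
  are then indexed by \<open>{..<n} <+> UNIV\<close>.\<close>

definition inner_on :: "'i set \<Rightarrow> ('i \<Rightarrow> complex) \<Rightarrow> ('i \<Rightarrow> complex) \<Rightarrow> complex" where
  "inner_on I f g = (\<Sum>i\<in>I. f i * cnj (g i))"

definition normsq_on :: "'i set \<Rightarrow> ('i \<Rightarrow> complex) \<Rightarrow> real" where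
  "normsq_on I f = (\<Sum>i\<in>I. (cmod (f i))\<^sup>2)"

definition matvec_on :: "'i set \<Rightarrow> ('j \<Rightarrow> 'i \<Rightarrow> complex) \<Rightarrow> ('i \<Rightarrow> complex) \<Rightarrow> 'j \<Rightarrow> complex" where
  "matvec_on I U h j = (\<Sum>i\<in>I. U j i * h i)"

definition adj_mat :: "('j \<Rightarrow> 'i \<Rightarrow> complex) \<Rightarrow> 'i \<Rightarrow> 'j \<Rightarrow> complex" where
  "adj_mat U i j = cnj (U j i)"

lemma inner_on_self: "inner_on I f f = complex_of_real (normsq_on I f)"
  by (simp add: inner_on_def normsq_on_def complex_norm_square[symmetric] del: of_real_power)

lemma cnj_inner_on: "cnj (inner_on I f g) = inner_on I g f"
  by (simp add: inner_on_def mult.commute)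

lemma inner_on_cong: "(\<And>i. i \<in> I \<Longrightarrow> f i = f' i) \<Longrightarrow> (\<And>i. i \<in> I \<Longrightarrow> g i = g' i) \<Longrightarrow> inner_on I f g = inner_on I f' g'"
  by (simp add: inner_on_def)

lemma normsq_on_cong: "(\<And>i. i \<in> I \<Longrightarrow> f i = f' i) \<Longrightarrow> normsq_on I f = normsq_on I f'"
  by (simp add: normsq_on_def)

lemma inner_on_diff_left: "inner_on I (\<lambda>i. f i - g i) h = inner_on I f h - inner_on I g h"
  by (simp add: inner_on_def algebra_simps sum_subtractf)

lemma inner_on_diff_right: "inner_on I h (\<lambda>i. f i - g i) = inner_on I h f - inner_on I h g"
  by (simp add: inner_on_def algebra_simps sum_subtractf)

lemma matvec_on_diff: "matvec_on I U (\<lambda>i. f i - g i) j = matvec_on I U f j - matvec_on I U g j"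
  by (simp add: matvec_on_def algebra_simps sum_subtractf)

lemma matvec_on_scale: "matvec_on I U (\<lambda>i. c * f i) j = c * matvec_on I U f j"
  by (simp add: matvec_on_def algebra_simps sum_distrib_left)

lemma inner_on_matvec_on: "inner_on J (matvec_on I U h) g = inner_on I h (matvec_on J (adj_mat U) g)"
proof -
  have "inner_on J (matvec_on I U h) g = (\<Sum>j\<in>J. \<Sum>i\<in>I. U j i * h i * cnj (g j))"
    by (simp add: inner_on_def matvec_on_def sum_distrib_right)
  also have "\<dots> = (\<Sum>i\<in>I. \<Sum>j\<in>J. U j i * h i * cnj (g j))"
    by (rule sum.swap)
  also have "\<dots> = inner_on I h (matvec_on J (adj_mat U) g)"
    by (simp add: inner_on_def matvec_on_def adj_mat_def sum_distrib_left mult_ac)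
  finally show ?thesis .
qed

lemma adj_mat_adj_mat [simp]: "adj_mat (adj_mat U) = U"
  by (simp add: adj_mat_def fun_eq_iff)

lemma normsq_on_pythagoras:
  assumes "inner_on I f g = 0"
  shows "normsq_on I (\<lambda>i. f i + c * g i) = normsq_on I f + (cmod c)\<^sup>2 * normsq_on I g"
proof -
  have g: "inner_on I g f = 0"
    using assms cnj_inner_on[of I f g] by simp
  have "inner_on I (\<lambda>i. f i + c * g i) (\<lambda>i. f i + c * g i)
      = inner_on I f f + cnj c * inner_on I f g + c * inner_on I g f + c * cnj c * inner_on I g g"
    by (simp add: inner_on_def algebra_simps sum.distrib sum_distrib_left)
  also have "\<dots> = complex_of_real (normsq_on I f + (cmod c)\<^sup>2 * normsq_on I g)"
    by (simp add: assms g inner_on_self complex_norm_square[symmetric])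
  finally show ?thesis
    by (simp only: inner_on_self of_real_eq_iff)
qed

lemma normsq_on_nonneg: "0 \<le> normsq_on I f"
  by (simp add: normsq_on_def sum_nonneg)

lemma normsq_on_eq_0: "finite I \<Longrightarrow> normsq_on I f = 0 \<longleftrightarrow> (\<forall>i\<in>I. f i = 0)"
  by (simp add: normsq_on_def sum_nonneg_eq_0_iff)

text \<open>Induction on \<open>n\<close>: each new pair contributes a rank-one term built from its
  components orthogonal to the earlier vectors. The two clauses on orthogonal complements strengthen
  the induction: they make \<open>U\<close> and its adjoint annihilate these components, on which
  both the normalization and the norm bound rely.\<close>

lemma partial_isometry_extension:
  fixes d :: "nat \<Rightarrow> 'i \<Rightarrow> complex" and r :: "nat \<Rightarrow> 'j \<Rightarrow> complex"
  assumes "finite I" "finite J"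
    and "\<forall>k<n. \<forall>l<n. inner_on I (d k) (d l) = inner_on J (r k) (r l)"
  shows "\<exists>U. (\<forall>k<n. \<forall>j\<in>J. matvec_on I U (d k) j = r k j) \<and>
             (\<forall>k<n. \<forall>i\<in>I. matvec_on J (adj_mat U) (r k) i = d k i) \<and>
             (\<forall>h. (\<forall>k<n. inner_on I h (d k) = 0) \<longrightarrow> (\<forall>j\<in>J. matvec_on I U h j = 0)) \<and>
             (\<forall>g. (\<forall>k<n. inner_on J g (r k) = 0) \<longrightarrow> (\<forall>i\<in>I. matvec_on J (adj_mat U) g i = 0)) \<and>
             (\<forall>h. normsq_on J (matvec_on I U h) \<le> normsq_on I h)"
    (is "?C n")
  using assms(3)
proof (induction n)
  case 0
  show ?case
    by (rule exI[of _ "\<lambda>_ _. 0"]) (simp add: matvec_on_def adj_mat_def normsq_on_def sum_nonneg)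
next
  case (Suc n)
  have gr: "\<forall>k<n. \<forall>l<n. inner_on I (d k) (d l) = inner_on J (r k) (r l)"
    using Suc.prems by simp
  have "?C n"
    using gr by (rule Suc.IH)
  then obtain U where
    Ud: "\<And>k j. k < n \<Longrightarrow> j \<in> J \<Longrightarrow> matvec_on I U (d k) j = r k j" and
    Ur: "\<And>k i. k < n \<Longrightarrow> i \<in> I \<Longrightarrow> matvec_on J (adj_mat U) (r k) i = d k i" and
    U0: "\<And>h j. (\<And>k. k < n \<Longrightarrow> inner_on I h (d k) = 0) \<Longrightarrow> j \<in> J \<Longrightarrow> matvec_on I U h j = 0" and
    A0: "\<And>g i. (\<And>k. k < n \<Longrightarrow> inner_on J g (r k) = 0) \<Longrightarrow> i \<in> I \<Longrightarrow> matvec_on J (adj_mat U) g i = 0" and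
    Uc: "\<And>h. normsq_on J (matvec_on I U h) \<le> normsq_on I h"
    by (elim exE conjE) (rule that, blast+)
  \<comment> \<open>By the Gram condition, the adjoint of \<open>U\<close> sends \<open>r n\<close>
    to the projection of \<open>d n\<close> onto the span of the earlier \<open>d k\<close>, and
    \<open>U\<close> sends \<open>d n\<close> to the projection of \<open>r n\<close>. Hence
    \<open>d'\<close> and \<open>r'\<close> are the components orthogonal to the earlier
    vectors.\<close>
  define d' where "d' = (\<lambda>i. d n i - matvec_on J (adj_mat U) (r n) i)"
  define r' where "r' = (\<lambda>j. r n j - matvec_on I U (d n) j)"
  define \<delta> where "\<delta> = normsq_on I d'"
  have d'k: "inner_on I d' (d k) = 0" if "k < n" for k
  proof -
    have "inner_on I (matvec_on J (adj_mat U) (r n)) (d k) = inner_on J (r n) (matvec_on I U (d k))"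
      by (simp add: inner_on_matvec_on)
    also have "\<dots> = inner_on J (r n) (r k)"
      by (rule inner_on_cong) (auto simp: Ud that)
    finally show ?thesis
      using Suc.prems that by (simp add: d'_def inner_on_diff_left)
  qed
  have r'k: "inner_on J r' (r k) = 0" if "k < n" for k
  proof -
    have "inner_on J (matvec_on I U (d n)) (r k) = inner_on I (d n) (matvec_on J (adj_mat U) (r k))"
      by (simp add: inner_on_matvec_on)
    also have "\<dots> = inner_on I (d n) (d k)"
      by (rule inner_on_cong) (auto simp: Ur that)
    finally show ?thesis
      using Suc.prems that by (simp add: r'_def inner_on_diff_left)
  qed
  have Ud': "matvec_on I U d' j = 0" if "j \<in> J" for j
    using U0 d'k that by blast
  have Ur': "matvec_on J (adj_mat U) r' i = 0" if "i \<in> I" for i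
    using A0 r'k that by blast
  have orth_d: "inner_on I d' (matvec_on J (adj_mat U) g) = 0" for g
    unfolding inner_on_matvec_on[symmetric] by (simp add: inner_on_def Ud')
  have orth_r: "inner_on J r' (matvec_on I U h) = 0" for h
    using inner_on_matvec_on[of I J "adj_mat U" r' h] by (simp add: inner_on_def Ur')
  have d'd: "inner_on I d' (d n) = \<delta>"
    using orth_d[of "r n"] inner_on_self[of I d']
    by (subst (asm) (3) d'_def) (simp add: inner_on_diff_right \<delta>_def)
  have r'r: "inner_on J r' (r n) = normsq_on J r'"
    using orth_r[of "d n"] inner_on_self[of J r']
    by (subst (asm) (3) r'_def) (simp add: inner_on_diff_right)
  \<comment> \<open>The subtracted terms are conjugate to each other and the \<open>(n, n)\<close>
    Gram entries agree, so the real parts coincide.\<close>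
  have \<delta>r: "normsq_on J r' = \<delta>"
  proof -
    have "inner_on I d' (d n) = inner_on I (d n) (d n) - inner_on J (r n) (matvec_on I U (d n))"
      by (simp add: d'_def inner_on_diff_left inner_on_matvec_on)
    moreover have "inner_on J r' (r n) = inner_on J (r n) (r n) - inner_on J (matvec_on I U (d n)) (r n)"
      by (simp add: r'_def inner_on_diff_left)
    moreover have "inner_on I (d n) (d n) = inner_on J (r n) (r n)"
      using Suc.prems by simp
    moreover have "Re (inner_on J (r n) (matvec_on I U (d n))) = Re (inner_on J (matvec_on I U (d n)) (r n))"
      by (metis cnj_inner_on complex_cnj(1) complex_cnj_cancel_iff cnj.sel(1))
    ultimately show ?thesis
      using d'd r'r by (metis Re_complex_of_real minus_complex.sel(1))
  qed
  show ?case
  proof (cases "\<delta> = 0")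
    case True
    then have "\<And>i. i \<in> I \<Longrightarrow> d' i = 0" "\<And>j. j \<in> J \<Longrightarrow> r' j = 0"
      using \<delta>r normsq_on_eq_0 assms(1,2) by (auto simp: \<delta>_def)
    then have "\<And>i. i \<in> I \<Longrightarrow> matvec_on J (adj_mat U) (r n) i = d n i"
      "\<And>j. j \<in> J \<Longrightarrow> matvec_on I U (d n) j = r n j"
      by (auto simp: d'_def r'_def)
    then show ?thesis
      by (intro exI[of _ U]) (auto simp: less_Suc_eq Ud Ur U0 A0 Uc)
  next
    case False
    \<comment> \<open>The rank-one update sends \<open>d'\<close> to \<open>r'\<close>; dividing by
      \<open>\<delta>\<close>, the common squared norm, normalizes it.\<close>
    define U1 where "U1 = (\<lambda>j i. U j i + r' j * cnj (d' i) / \<delta>)"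
    have U1: "matvec_on I U1 h j = matvec_on I U h j + inner_on I h d' / \<delta> * r' j" for h j
      by (simp add: matvec_on_def U1_def inner_on_def algebra_simps sum.distrib sum_distrib_left
          sum_divide_distrib)
    have A1: "matvec_on J (adj_mat U1) g i = matvec_on J (adj_mat U) g i + inner_on J g r' / \<delta> * d' i" for g i
      by (simp add: matvec_on_def U1_def adj_mat_def inner_on_def algebra_simps sum.distrib sum_distrib_left
          sum_divide_distrib)
    have dd': "inner_on I (d n) d' = \<delta>" and rr': "inner_on J (r n) r' = \<delta>"
      by (simp_all add: cnj_inner_on[of I d' "d n", symmetric] cnj_inner_on[of J r' "r n", symmetric] d'd r'r \<delta>r)
    have kd': "inner_on I (d k) d' = 0" and kr': "inner_on J (r k) r' = 0" if "k < n" for k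
      using that by (simp_all add: cnj_inner_on[of I d' "d k", symmetric] cnj_inner_on[of J r' "r k", symmetric] d'k r'k)
    have "normsq_on J (matvec_on I U1 h) \<le> normsq_on I h" for h
    proof -
      \<comment> \<open>Split off the component of \<open>h\<close> along \<open>d'\<close>. Since
        \<open>U\<close> kills \<open>d'\<close> and the range of \<open>U\<close> is orthogonal to
        \<open>r'\<close>, Pythagoras adds the same term \<open>(cmod c)\<^sup>2 * \<delta>\<close>
        on both sides.\<close>
      define c where "c = inner_on I h d' / \<delta>"
      define h0 where "h0 = (\<lambda>i. h i - c * d' i)"
      have h0: "inner_on I h0 d' = 0"
      proof -
        have "inner_on I (\<lambda>i. c * d' i) d' = c * inner_on I d' d'"
          by (simp add: inner_on_def sum_distrib_left algebra_simps)
        then show ?thesis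
          using False by (simp add: h0_def inner_on_diff_left inner_on_self c_def \<delta>_def)
      qed
      have "normsq_on I h = normsq_on I (\<lambda>i. h0 i + c * d' i)"
        by (simp add: h0_def)
      also have "\<dots> = normsq_on I h0 + (cmod c)\<^sup>2 * \<delta>"
        using normsq_on_pythagoras[OF h0] by (simp add: \<delta>_def)
      finally have 1: "normsq_on I h = normsq_on I h0 + (cmod c)\<^sup>2 * \<delta>" .
      have 2: "inner_on J (matvec_on I U h) r' = 0"
        using orth_r[of h] cnj_inner_on[of J r' "matvec_on I U h"] by simp
      have "normsq_on J (matvec_on I U1 h) = normsq_on J (\<lambda>j. matvec_on I U h j + c * r' j)"
        by (simp add: U1 c_def cong: normsq_on_cong)
      also have "\<dots> = normsq_on J (matvec_on I U h) + (cmod c)\<^sup>2 * \<delta>"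
        using normsq_on_pythagoras[OF 2] \<delta>r by simp
      also have "normsq_on J (matvec_on I U h) = normsq_on J (matvec_on I U h0)"
        by (rule normsq_on_cong) (simp add: h0_def matvec_on_diff matvec_on_scale Ud')
      finally show ?thesis
        using 1 Uc[of h0] by simp
    qed
    moreover have "matvec_on I U1 (d k) j = r k j" if "k < Suc n" "j \<in> J" for k j
      using that False by (auto simp: less_Suc_eq U1 Ud kd' dd' r'_def)
    moreover have "matvec_on J (adj_mat U1) (r k) i = d k i" if "k < Suc n" "i \<in> I" for k i
      using that False by (auto simp: less_Suc_eq A1 Ur kr' rr' d'_def)
    moreover have "matvec_on I U1 h j = 0" if h: "\<forall>k<Suc n. inner_on I h (d k) = 0" and "j \<in> J" for h j
    proof -
      have Uh: "\<And>j. j \<in> J \<Longrightarrow> matvec_on I U h j = 0"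
        using U0 h by simp
      have "inner_on I h (matvec_on J (adj_mat U) (r n)) = 0"
        unfolding inner_on_matvec_on[symmetric] by (simp add: inner_on_def Uh)
      then have "inner_on I h d' = 0"
        using h by (simp add: d'_def inner_on_diff_right)
      then show ?thesis
        by (simp add: U1 Uh that)
    qed
    moreover have "matvec_on J (adj_mat U1) g i = 0" if g: "\<forall>k<Suc n. inner_on J g (r k) = 0" and "i \<in> I" for g i
    proof -
      have Ug: "\<And>i. i \<in> I \<Longrightarrow> matvec_on J (adj_mat U) g i = 0"
        using A0 g by simp
      have "inner_on J g (matvec_on I U (d n)) = 0"
        using inner_on_matvec_on[of I J "adj_mat U" g "d n"] by (simp add: inner_on_def Ug)
      then have "inner_on J g r' = 0"
        using g by (simp add: r'_def inner_on_diff_right)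
      then show ?thesis
        by (simp add: A1 Ug that)
    qed
    ultimately show ?thesis
      by blast
  qed
qed

corollary lurking_isometry:
  fixes d :: "nat \<Rightarrow> 'i \<Rightarrow> complex" and r :: "nat \<Rightarrow> 'j \<Rightarrow> complex"
  assumes "finite I" "finite J"
    and "\<And>k l. k < n \<Longrightarrow> l < n \<Longrightarrow> inner_on I (d k) (d l) = inner_on J (r k) (r l)"
  obtains U where "\<And>k j. k < n \<Longrightarrow> j \<in> J \<Longrightarrow> matvec_on I U (d k) j = r k j"
    and "\<And>k i. k < n \<Longrightarrow> i \<in> I \<Longrightarrow> matvec_on J (adj_mat U) (r k) i = d k i"
    and "\<And>h. normsq_on J (matvec_on I U h) \<le> normsq_on I h"
proof -
  have gram: "\<forall>k<n. \<forall>l<n. inner_on I (d k) (d l) = inner_on J (r k) (r l)"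
    using assms(3) by blast
  show thesis
    using partial_isometry_extension[OF assms(1,2) gram] by (elim exE conjE) (rule that, blast+)
qed

section \<open>Gram factorization of positive semidefinite matrices\<close>

lemma quadratic_form_Suc:
  fixes P :: "nat \<Rightarrow> nat \<Rightarrow> complex"
  assumes "\<And>k l. k < Suc n \<Longrightarrow> l < Suc n \<Longrightarrow> P l k = cnj (P k l)"
  defines "s c \<equiv> (\<Sum>k<n. c k * P k n)"
  shows "(\<Sum>k<Suc n. \<Sum>l<Suc n. c k * P k l * cnj (c l)) =
    (\<Sum>k<n. \<Sum>l<n. c k * P k l * cnj (c l)) + s c * cnj (c n) + c n * cnj (s c) + c n * P n n * cnj (c n)"
proof -
  have "(\<Sum>l<n. c n * P n l * cnj (c l)) = c n * cnj (s c)"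
    unfolding s_def by (simp add: sum_distrib_left mult_ac) (rule sum.cong, simp, subst assms(1)[of n], auto)
  moreover have "(\<Sum>k<n. c k * P k n * cnj (c n)) = s c * cnj (c n)"
    unfolding s_def by (simp add: sum_distrib_right)
  ultimately show ?thesis
    by (simp add: sum.distrib)
qed

text \<open>Cholesky elimination of the last row and column. Singular matrices are covered because a
  zero pivot forces its whole column to vanish.\<close>

lemma gram_factorization:
  fixes P :: "nat \<Rightarrow> nat \<Rightarrow> complex"
  assumes "\<And>k l. k < n \<Longrightarrow> l < n \<Longrightarrow> P l k = cnj (P k l)"
    and "\<And>c. 0 \<le> Re (\<Sum>k<n. \<Sum>l<n. c k * P k l * cnj (c l))"
  shows "\<exists>g. \<forall>k<n. \<forall>l<n. P k l = inner_on {..<n} (g k) (g l)"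
  using assms
proof (induction n arbitrary: P)
  case 0
  then show ?case by simp
next
  case (Suc n)
  define a where "a = Re (P n n)"
  have Pnn: "P n n = complex_of_real a"
    using Suc.prems(1)[of n n] by (simp add: a_def complex_eq_iff)
  have Pcnj: "P n k = cnj (P k n)" if "k < n" for k
    using Suc.prems(1)[of k n] that by simp
  define s where "s c = (\<Sum>k<n. c k * P k n)" for c
  define F where "F c = (\<Sum>k<n. \<Sum>l<n. c k * P k l * cnj (c l))" for c
  have form: "0 \<le> Re (F c + s c * cnj b + b * cnj (s c) + b * a * cnj b)" for c b
  proof -
    define c' where "c' = c(n := b)"
    have c': "F c' = F c" "s c' = s c" "c' n = b"
      by (simp_all add: F_def s_def c'_def)
    have "(\<Sum>k<Suc n. \<Sum>l<Suc n. c' k * P k l * cnj (c' l))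
        = F c' + s c' * cnj (c' n) + c' n * cnj (s c') + c' n * P n n * cnj (c' n)"
      unfolding F_def s_def by (rule quadratic_form_Suc) (rule Suc.prems(1))
    then show ?thesis
      using Suc.prems(2)[of c'] by (simp only: c' Pnn)
  qed
  have a: "0 \<le> a"
    using form[of "\<lambda>_. 0" 1] by (simp add: F_def s_def)
  \<comment> \<open>With a zero pivot the form is affine along a ray in the last coordinate, so a
    nonzero entry of the column would drive it below 0.\<close>
  have Pkn0: "P k n = 0" if "a = 0" "k < n" for k
  proof (rule ccontr)
    assume nz: "P k n \<noteq> 0"
    define c :: "nat \<Rightarrow> complex" where "c = (\<lambda>j. if j = k then 1 else 0)"
    have sc: "s c = P k n"
      using that by (simp add: s_def c_def sum.delta if_distrib[of "\<lambda>x. x * _"] cong: if_cong)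
    \<comment> \<open>Chosen so that the decrease is \<open>2 * (1 + \<bar>Re (F c)\<bar>)\<close>,
      which exceeds \<open>Re (F c)\<close>.\<close>
    define t where "t = (1 + \<bar>Re (F c)\<bar>) / (cmod (P k n))\<^sup>2"
    have "0 \<le> Re (F c + s c * cnj (- t * s c) + (- t * s c) * cnj (s c))"
      using form[of c "- t * s c"] that by simp
    also have "\<dots> = Re (F c) - 2 * t * (cmod (s c))\<^sup>2"
      unfolding cmod_power2 by (simp add: algebra_simps power2_eq_square)
    also have "\<dots> = Re (F c) - 2 * (1 + \<bar>Re (F c)\<bar>)"
      using nz by (simp add: sc t_def)
    finally show False
      by (simp add: abs_if split: if_splits)
  qed
  \<comment> \<open>The Schur complement of the pivot. If \<open>a = 0\<close>, division by zero
    gives 0 and \<open>Q\<close> is just \<open>P\<close>, consistently with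
    \<open>Pkn0\<close>.\<close>
  define Q where "Q k l = P k l - P k n * P n l / a" for k l
  have "\<exists>g. \<forall>k<n. \<forall>l<n. Q k l = inner_on {..<n} (g k) (g l)"
  proof (rule Suc.IH)
    show "Q l k = cnj (Q k l)" if "k < n" "l < n" for k l
      using that Suc.prems(1)[of k l] Pcnj by (simp add: Q_def)
    show "0 \<le> Re (\<Sum>k<n. \<Sum>l<n. c k * Q k l * cnj (c l))" for c
    proof -
      have "(\<Sum>k<n. \<Sum>l<n. c k * Q k l * cnj (c l)) =
          F c - (\<Sum>k<n. \<Sum>l<n. (c k * P k n) * cnj (c l * P l n)) / a"
        by (simp add: F_def Q_def algebra_simps sum_subtractf sum_divide_distrib Pcnj)
      also have "(\<Sum>k<n. \<Sum>l<n. (c k * P k n) * cnj (c l * P l n)) = s c * cnj (s c)"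
        by (simp add: s_def sum_product)
      \<comment> \<open>Completing the square: the form of \<open>Q\<close> is the form of
        \<open>P\<close> with last coordinate \<open>- s c / a\<close>.\<close>
      also have "F c - s c * cnj (s c) / a =
          F c + s c * cnj (- s c / a) + (- s c / a) * cnj (s c) + (- s c / a) * a * cnj (- s c / a)"
        by (cases "a = 0") (auto simp: field_simps)
      finally show ?thesis
        using form[of c "- s c / a"] by simp
    qed
  qed
  then obtain g where g: "\<And>k l. k < n \<Longrightarrow> l < n \<Longrightarrow> Q k l = inner_on {..<n} (g k) (g l)"
    by blast
  \<comment> \<open>Coordinate \<open>n\<close> restores the subtracted rank-one term; the new
    vector \<open>g' n\<close> has no other coordinate, so its products with the others see only
    column \<open>n\<close> of \<open>P\<close>.\<close>
  define g' where "g' k j = (if j = n then P k n / sqrt a else if k = n then 0 else g k j)" for k j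
  have g'n: "g' n n = sqrt a"
    using a by (simp add: g'_def Pnn real_div_sqrt flip: of_real_divide)
  have sq: "complex_of_real (sqrt a) * complex_of_real (sqrt a) = a"
    using a by (simp flip: of_real_mult)
  have "P k l = inner_on {..<Suc n} (g' k) (g' l)" if kl: "k < Suc n" "l < Suc n" for k l
  proof -
    have split: "inner_on {..<Suc n} (g' k) (g' l) = inner_on {..<n} (g' k) (g' l) + g' k n * cnj (g' l n)"
      by (simp add: inner_on_def)
    consider "k < n" "l < n" | "k < n" "l = n" | "k = n" "l < n" | "k = n" "l = n"
      using kl by linarith
    then show ?thesis
    proof cases
      case 1
      have "inner_on {..<n} (g' k) (g' l) = Q k l"
        unfolding g[OF 1] by (rule inner_on_cong) (use 1 in \<open>auto simp: g'_def\<close>)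
      moreover have "g' k n * cnj (g' l n) = P k n * P n l / a"
        using 1 Pcnj by (simp add: g'_def sq)
      ultimately show ?thesis
        by (simp add: split Q_def)
    next
      case 2
      have "inner_on {..<n} (g' k) (g' n) = 0"
        by (simp add: inner_on_def g'_def)
      moreover have "g' k n * sqrt a = P k n"
        using Pkn0[of k] 2 by (cases "a = 0") (auto simp: g'_def)
      ultimately show ?thesis
        using split 2 by (simp add: g'n)
    next
      case 3
      have "inner_on {..<n} (g' n) (g' l) = 0"
        by (simp add: inner_on_def g'_def)
      moreover have "sqrt a * cnj (g' l n) = P n l"
        using Pkn0[of l] Pcnj[of l] 3 by (cases "a = 0") (auto simp: g'_def)
      ultimately show ?thesis
        using split 3 by (simp add: g'n)
    next
      case 4
      have "inner_on {..<n} (g' n) (g' n) = 0"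
        by (simp add: inner_on_def g'_def)
      then show ?thesis
        using split 4 by (simp add: g'n Pnn sq)
    qed
  qed
  then show ?case
    by blast
qed

section \<open>Transfer functions of contractions\<close>

text \<open>\<open>K \<zeta>\<close> is \<open>(1 - \<zeta> A)\<^sup>-\<^sup>1 B\<close> as a
  Neumann series. Contractivity of \<open>A\<close> bounds the coefficients
  \<open>A\<^sup>q B\<close> uniformly in \<open>q\<close>, so the series converges on the whole
  open disc and no invertibility argument is required.\<close>

lemma resolvent_power_series:
  fixes A :: "nat \<Rightarrow> nat \<Rightarrow> complex" and B :: "nat \<Rightarrow> 'm \<Rightarrow> complex"
  assumes A: "\<And>h. normsq_on {..<n} (matvec_on {..<n} A h) \<le> normsq_on {..<n} h"
  obtains K where "\<And>s j. s < n \<Longrightarrow> (\<lambda>\<zeta>. K \<zeta> s j) holomorphic_on ball 0 1"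
    and "\<And>\<zeta> s j. cmod \<zeta> < 1 \<Longrightarrow> s < n \<Longrightarrow> K \<zeta> s j = B s j + \<zeta> * (\<Sum>t<n. A s t * K \<zeta> t j)"
proof
  define X where "X j q = ((matvec_on {..<n} A) ^^ q) (\<lambda>s. B s j)" for j q
  define M where "M j = sqrt (normsq_on {..<n} (X j 0))" for j
  have normsq_onX: "normsq_on {..<n} (X j q) \<le> normsq_on {..<n} (X j 0)" for j q
    by (induction q) (auto simp: X_def intro: order_trans[OF A])
  have X: "cmod (X j q s) \<le> M j" if "s < n" for j q s
  proof -
    have "(cmod (X j q s))\<^sup>2 \<le> normsq_on {..<n} (X j q)"
      unfolding normsq_on_def using that by (intro member_le_sum) auto
    then show ?thesis
      unfolding M_def using normsq_onX by (intro real_le_rsqrt) (rule order_trans)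
  qed
  define K where "K \<zeta> s j = (\<Sum>q. X j q s * \<zeta> ^ q)" for \<zeta> s j
  have K: "(\<lambda>q. X j q s * \<zeta> ^ q) sums K \<zeta> s j" if "cmod \<zeta> < 1" "s < n" for \<zeta> s j
  proof -
    have "summable (\<lambda>q. X j q s * \<zeta> ^ q)"
    proof (rule summable_comparison_test')
      show "summable (\<lambda>q. M j * cmod \<zeta> ^ q)"
        using that by (intro summable_mult summable_geometric) simp
      show "norm (X j q s * \<zeta> ^ q) \<le> M j * cmod \<zeta> ^ q" if "0 \<le> q" for q
        using X[OF \<open>s < n\<close>] by (simp add: norm_mult norm_power mult_right_mono)
    qed
    then show ?thesis
      by (simp add: K_def summable_sums)
  qed
  show "(\<lambda>\<zeta>. K \<zeta> s j) holomorphic_on ball 0 1" if "s < n" for s j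
  proof (rule power_series_holomorphic)
    show "(\<lambda>q. X j q s * (w - 0) ^ q) sums K w s j" if "w \<in> ball 0 1" for w
      using K[OF _ \<open>s < n\<close>] that by simp
  qed
  show "K \<zeta> s j = B s j + \<zeta> * (\<Sum>t<n. A s t * K \<zeta> t j)" if \<zeta>: "cmod \<zeta> < 1" and s: "s < n" for \<zeta> s j
  proof -
    have "(\<lambda>q. \<zeta> * (\<Sum>t<n. A s t * (X j q t * \<zeta> ^ q))) sums (\<zeta> * (\<Sum>t<n. A s t * K \<zeta> t j))"
      using K \<zeta> by (intro sums_mult sums_sum) auto
    moreover have "\<zeta> * (\<Sum>t<n. A s t * (X j q t * \<zeta> ^ q)) = X j (Suc q) s * \<zeta> ^ Suc q" for q
      by (simp add: X_def matvec_on_def sum_distrib_left sum_distrib_right mult_ac)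
    ultimately have "(\<lambda>q. X j (Suc q) s * \<zeta> ^ Suc q) sums (\<zeta> * (\<Sum>t<n. A s t * K \<zeta> t j))"
      by simp
    then have "(\<lambda>q. X j q s * \<zeta> ^ q) sums (\<zeta> * (\<Sum>t<n. A s t * K \<zeta> t j) + X j 0 s * \<zeta> ^ 0)"
      by (subst (asm) sums_Suc_iff) simp
    then show ?thesis
      using K[OF \<zeta> s] sums_unique2 by (fastforce simp: X_def)
  qed
qed

section \<open>Nodes of a block matrix and its transfer function\<close>

lemma sum_Plus_UNIV:
  fixes f :: "nat + 'm::finite \<Rightarrow> 'c::comm_monoid_add"
  shows "sum f ({..<n} <+> UNIV) = (\<Sum>s<n. f (Inl s)) + (\<Sum>j\<in>UNIV. f (Inr j))"
  by (simp add: sum.Plus)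

lemma norm_vec_power2: "(norm (b :: complex ^ 'm))\<^sup>2 = (\<Sum>j\<in>UNIV. (cmod (b $ j))\<^sup>2)"
  by (simp add: norm_vec_def L2_set_def sum_nonneg)

text \<open>In block form \<open>(\<zeta> l, x) U = (l, y)\<close>. Eliminating the row state,
  \<open>l = x C (1 - \<zeta> A)\<^sup>-\<^sup>1\<close>, turns this into
  \<open>x T(\<zeta>) = y\<close> for the transfer function \<open>T\<close>.\<close>

definition left_node ::
    "(nat + 'p::finite \<Rightarrow> nat + 'm::finite \<Rightarrow> complex) \<Rightarrow> nat \<Rightarrow> complex \<Rightarrow>
     (nat \<Rightarrow> complex) \<Rightarrow> complex ^ 'p \<Rightarrow> complex ^ 'm \<Rightarrow> bool" where
  "left_node U n \<zeta> l x y \<longleftrightarrow>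
    (\<forall>t<n. l t = (\<Sum>s<n. \<zeta> * l s * U (Inl s) (Inl t)) + (\<Sum>i\<in>UNIV. x $ i * U (Inr i) (Inl t))) \<and>
    (\<forall>j. y $ j = (\<Sum>s<n. \<zeta> * l s * U (Inl s) (Inr j)) + (\<Sum>i\<in>UNIV. x $ i * U (Inr i) (Inr j)))"

text \<open>The column version \<open>U (\<zeta> k, u) = (k, v)\<close>, with state
  \<open>k = (1 - \<zeta> A)\<^sup>-\<^sup>1 B u\<close> and
  \<open>T(\<zeta>) u = v\<close>.\<close>

definition right_node ::
    "(nat + 'p::finite \<Rightarrow> nat + 'm::finite \<Rightarrow> complex) \<Rightarrow> nat \<Rightarrow> complex \<Rightarrow>
     (nat \<Rightarrow> complex) \<Rightarrow> complex ^ 'm \<Rightarrow> complex ^ 'p \<Rightarrow> bool" where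
  "right_node U n \<zeta> k u v \<longleftrightarrow>
    (\<forall>s<n. k s = (\<Sum>t<n. U (Inl s) (Inl t) * (\<zeta> * k t)) + (\<Sum>j\<in>UNIV. U (Inl s) (Inr j) * u $ j)) \<and>
    (\<forall>i. v $ i = (\<Sum>t<n. U (Inr i) (Inl t) * (\<zeta> * k t)) + (\<Sum>j\<in>UNIV. U (Inr i) (Inr j) * u $ j))"

text \<open>The transfer function \<open>T \<zeta> = D + \<zeta> C (1 - \<zeta> A)\<^sup>-\<^sup>1 B\<close> of a contractive block matrix
  \<open>U\<close> with blocks \<open>A\<close>, \<open>B\<close>, \<open>C\<close>, \<open>D\<close>.\<close>

lemma transfer_function:
  fixes U :: "nat + 'p::finite \<Rightarrow> nat + 'm::finite \<Rightarrow> complex"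
  assumes U: "\<And>h. normsq_on ({..<n} <+> UNIV) (matvec_on ({..<n} <+> UNIV) U h) \<le> normsq_on ({..<n} <+> UNIV) h"
  obtains T :: "complex \<Rightarrow> complex ^ 'm ^ 'p"
  where "\<And>i j. (\<lambda>\<zeta>. T \<zeta> $ i $ j) holomorphic_on ball 0 1"
    and "\<And>\<zeta>. cmod \<zeta> < 1 \<Longrightarrow> onorm ((*v) (T \<zeta>)) \<le> 1"
    and "\<And>\<zeta> l x y. cmod \<zeta> < 1 \<Longrightarrow> left_node U n \<zeta> l x y \<Longrightarrow> x v* T \<zeta> = y"
    and "\<And>\<zeta> k u v. cmod \<zeta> < 1 \<Longrightarrow> right_node U n \<zeta> k u v \<Longrightarrow> T \<zeta> *v u = v"
    and "\<And>\<zeta> l x y k u v. cmod \<zeta> < 1 \<Longrightarrow> left_node U n \<zeta> l x y \<Longrightarrow> right_node U n \<zeta> k u v \<Longrightarrow>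
           scalar_product x (mat_deriv T \<zeta> *v u) = (\<Sum>s<n. l s * k s)"
proof -
  define A B C D where "A = (\<lambda>s t. U (Inl s) (Inl t))" and "B = (\<lambda>s j. U (Inl s) (Inr j))"
    and "C = (\<lambda>i s. U (Inr i) (Inl s))" and "D = (\<lambda>i j. U (Inr i) (Inr j))"
  note blocks = A_def B_def C_def D_def
  have U': "(\<Sum>s<n. (cmod ((\<Sum>t<n. A s t * h t) + (\<Sum>j\<in>UNIV. B s j * b $ j)))\<^sup>2) +
      (\<Sum>i\<in>UNIV. (cmod ((\<Sum>t<n. C i t * h t) + (\<Sum>j\<in>UNIV. D i j * b $ j)))\<^sup>2)
    \<le> (\<Sum>s<n. (cmod (h s))\<^sup>2) + (norm b)\<^sup>2" for h and b :: "complex ^ 'm"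
    using U[of "case_sum h (\<lambda>j. b $ j)"]
    by (simp add: normsq_on_def matvec_on_def sum_Plus_UNIV norm_vec_power2 blocks)
  have A: "normsq_on {..<n} (matvec_on {..<n} A h) \<le> normsq_on {..<n} h" for h
  proof -
    have "0 \<le> (\<Sum>i\<in>UNIV. (cmod (\<Sum>t<n. C i t * h t))\<^sup>2)"
      by (simp add: sum_nonneg)
    then show ?thesis
      using U'[of h 0] by (simp add: normsq_on_def matvec_on_def)
  qed
  obtain K where K_hol: "\<And>s j. s < n \<Longrightarrow> (\<lambda>\<zeta>. K \<zeta> s j) holomorphic_on ball 0 1"
    and K: "\<And>\<zeta> s j. cmod \<zeta> < 1 \<Longrightarrow> s < n \<Longrightarrow> K \<zeta> s j = B s j + \<zeta> * (\<Sum>t<n. A s t * K \<zeta> t j)"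
    by (rule resolvent_power_series[OF A, where B = B]) blast
  define T :: "complex \<Rightarrow> complex ^ 'm ^ 'p"
    where "T \<zeta> = (\<chi> i j. D i j + \<zeta> * (\<Sum>s<n. C i s * K \<zeta> s j))" for \<zeta>
  have Tv: "(T \<zeta> *v b) $ i = (\<Sum>j\<in>UNIV. D i j * b $ j) + (\<Sum>s<n. C i s * (\<zeta> * (\<Sum>j\<in>UNIV. K \<zeta> s j * b $ j)))"
    for \<zeta> b i
  proof -
    have "(T \<zeta> *v b) $ i = (\<Sum>j\<in>UNIV. D i j * b $ j) + (\<Sum>j\<in>UNIV. \<Sum>s<n. C i s * (\<zeta> * (K \<zeta> s j * b $ j)))"
      by (simp add: T_def matrix_vector_mult_def algebra_simps sum.distrib sum_distrib_left)
    also have "(\<Sum>j\<in>UNIV. \<Sum>s<n. C i s * (\<zeta> * (K \<zeta> s j * b $ j))) =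
        (\<Sum>s<n. \<Sum>j\<in>UNIV. C i s * (\<zeta> * (K \<zeta> s j * b $ j)))"
      by (rule sum.swap)
    finally show ?thesis
      by (simp add: sum_distrib_left)
  qed
  have Kv: "(\<Sum>j\<in>UNIV. K \<zeta> s j * b $ j) =
      (\<Sum>t<n. A s t * (\<zeta> * (\<Sum>j\<in>UNIV. K \<zeta> t j * b $ j))) + (\<Sum>j\<in>UNIV. B s j * b $ j)"
    if "cmod \<zeta> < 1" "s < n" for \<zeta> s and b :: "complex ^ 'm"
  proof -
    have "(\<Sum>j\<in>UNIV. K \<zeta> s j * b $ j) =
        (\<Sum>j\<in>UNIV. B s j * b $ j) + (\<Sum>j\<in>UNIV. \<Sum>t<n. A s t * (\<zeta> * (K \<zeta> t j * b $ j)))"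
      by (subst K[OF that]) (simp add: algebra_simps sum.distrib sum_distrib_left)
    also have "(\<Sum>j\<in>UNIV. \<Sum>t<n. A s t * (\<zeta> * (K \<zeta> t j * b $ j))) =
        (\<Sum>t<n. \<Sum>j\<in>UNIV. A s t * (\<zeta> * (K \<zeta> t j * b $ j)))"
      by (rule sum.swap)
    finally show ?thesis
      by (simp add: sum_distrib_left)
  qed
  have T_hol: "(\<lambda>\<zeta>. T \<zeta> $ i $ j) holomorphic_on ball 0 1" for i j
    using K_hol by (auto simp: T_def intro!: holomorphic_intros)
  \<comment> \<open>Energy balance: \<open>U\<close> maps \<open>(\<zeta> k, b)\<close> to
    \<open>(k, T \<zeta> b)\<close> and is contractive, and the state norms cancel because
    \<open>cmod \<zeta> < 1\<close>.\<close>
  have T_norm: "norm (T \<zeta> *v b) \<le> norm b" if \<zeta>: "cmod \<zeta> < 1" for \<zeta> b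
  proof -
    define k where "k s = (\<Sum>j\<in>UNIV. K \<zeta> s j * b $ j)" for s
    have kA: "(\<Sum>t<n. A s t * (\<zeta> * k t)) + (\<Sum>j\<in>UNIV. B s j * b $ j) = k s" if "s < n" for s
      using Kv[OF \<zeta> that, of b] by (simp add: k_def)
    have kT: "(\<Sum>t<n. C i t * (\<zeta> * k t)) + (\<Sum>j\<in>UNIV. D i j * b $ j) = (T \<zeta> *v b) $ i" for i
      by (simp add: k_def Tv)
    have "(\<Sum>s<n. (cmod (k s))\<^sup>2) + (norm (T \<zeta> *v b))\<^sup>2 =
      (\<Sum>s<n. (cmod ((\<Sum>t<n. A s t * (\<zeta> * k t)) + (\<Sum>j\<in>UNIV. B s j * b $ j)))\<^sup>2) +
      (\<Sum>i\<in>UNIV. (cmod ((\<Sum>t<n. C i t * (\<zeta> * k t)) + (\<Sum>j\<in>UNIV. D i j * b $ j)))\<^sup>2)"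
      by (simp add: kA kT norm_vec_power2)
    also have "\<dots> \<le> (\<Sum>s<n. (cmod (\<zeta> * k s))\<^sup>2) + (norm b)\<^sup>2"
      by (rule U')
    also have "\<dots> \<le> (\<Sum>s<n. (cmod (k s))\<^sup>2) + (norm b)\<^sup>2"
      using \<zeta> by (intro add_right_mono sum_mono power_mono) (auto simp: norm_mult mult_left_le_one_le)
    finally have "(norm (T \<zeta> *v b))\<^sup>2 \<le> (norm b)\<^sup>2"
      by simp
    then show ?thesis
      by (rule power2_le_imp_le) simp
  qed
  \<comment> \<open>The node equation reads \<open>x C = l (1 - \<zeta> A)\<close>; moving the
    resolvent factor onto \<open>\<kappa>\<close> prepares for cancelling it against
    \<open>K\<close>.\<close>
  have xC: "(\<Sum>s<n. (\<Sum>i\<in>UNIV. x $ i * C i s) * \<kappa> s) = (\<Sum>s<n. l s * (\<kappa> s - \<zeta> * (\<Sum>t<n. A s t * \<kappa> t)))"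
    if "left_node U n \<zeta> l x y" for \<zeta> l x y \<kappa>
  proof -
    have "(\<Sum>i\<in>UNIV. x $ i * C i s) = l s - (\<Sum>t<n. \<zeta> * l t * A t s)" if "s < n" for s
    proof -
      have "l s = (\<Sum>t<n. \<zeta> * l t * A t s) + (\<Sum>i\<in>UNIV. x $ i * C i s)"
        using \<open>left_node U n \<zeta> l x y\<close> that unfolding left_node_def blocks by blast
      then show ?thesis
        by simp
    qed
    then have "(\<Sum>s<n. (\<Sum>i\<in>UNIV. x $ i * C i s) * \<kappa> s) = (\<Sum>s<n. (l s - (\<Sum>t<n. \<zeta> * l t * A t s)) * \<kappa> s)"
      by simp
    also have "\<dots> = (\<Sum>s<n. l s * \<kappa> s) - (\<Sum>s<n. \<Sum>t<n. \<zeta> * l t * A t s * \<kappa> s)"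
      by (simp add: left_diff_distrib sum_subtractf sum_distrib_right)
    also have "(\<Sum>s<n. \<Sum>t<n. \<zeta> * l t * A t s * \<kappa> s) = (\<Sum>t<n. \<Sum>s<n. \<zeta> * l t * A t s * \<kappa> s)"
      by (rule sum.swap)
    finally show ?thesis
      by (simp add: right_diff_distrib sum_subtractf sum_distrib_left mult_ac)
  qed
  have left: "x v* T \<zeta> = y" if \<zeta>: "cmod \<zeta> < 1" and LN: "left_node U n \<zeta> l x y" for \<zeta> l x y
  proof -
    have "(x v* T \<zeta>) $ j = y $ j" for j
    proof -
      have "(x v* T \<zeta>) $ j = (\<Sum>i\<in>UNIV. x $ i * D i j) + \<zeta> * (\<Sum>i\<in>UNIV. \<Sum>s<n. x $ i * C i s * K \<zeta> s j)"
        by (simp add: T_def vector_matrix_mult_def algebra_simps sum.distrib sum_distrib_left)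
      also have "(\<Sum>i\<in>UNIV. \<Sum>s<n. x $ i * C i s * K \<zeta> s j) = (\<Sum>s<n. \<Sum>i\<in>UNIV. x $ i * C i s * K \<zeta> s j)"
        by (rule sum.swap)
      also have "\<dots> = (\<Sum>s<n. (\<Sum>i\<in>UNIV. x $ i * C i s) * K \<zeta> s j)"
        by (simp add: sum_distrib_right)
      also have "\<dots> = (\<Sum>s<n. l s * (K \<zeta> s j - \<zeta> * (\<Sum>t<n. A s t * K \<zeta> t j)))"
        by (rule xC[OF LN])
      also have "\<dots> = (\<Sum>s<n. l s * B s j)"
      proof (intro sum.cong refl arg_cong2[of _ _ _ _ "(*)"])
        fix s assume "s \<in> {..<n}"
        then show "K \<zeta> s j - \<zeta> * (\<Sum>t<n. A s t * K \<zeta> t j) = B s j"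
          using K[OF \<zeta>, of s j] by simp
      qed
      finally have "(x v* T \<zeta>) $ j = (\<Sum>s<n. \<zeta> * l s * B s j) + (\<Sum>i\<in>UNIV. x $ i * D i j)"
        by (simp add: sum_distrib_left mult_ac)
      also have "\<dots> = y $ j"
        using LN unfolding left_node_def blocks by metis
      finally show ?thesis .
    qed
    then show ?thesis
      by (simp add: Finite_Cartesian_Product.vec_eq_iff)
  qed
  \<comment> \<open>The state of a right node is unique: the difference \<open>e\<close> of two
    candidates satisfies \<open>e = \<zeta> A e\<close>, and \<open>A\<close> is contractive while
    \<open>cmod \<zeta> < 1\<close>.\<close>
  have kK: "k s = (\<Sum>j\<in>UNIV. K \<zeta> s j * u $ j)" if \<zeta>: "cmod \<zeta> < 1" and RN: "right_node U n \<zeta> k u v" and "s < n"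
    for \<zeta> k u v s
  proof -
    define e where "e s = k s - (\<Sum>j\<in>UNIV. K \<zeta> s j * u $ j)" for s
    have e: "e s = \<zeta> * matvec_on {..<n} A e s" if "s < n" for s
    proof -
      have "k s = (\<Sum>t<n. A s t * (\<zeta> * k t)) + (\<Sum>j\<in>UNIV. B s j * u $ j)"
        using RN that unfolding right_node_def blocks by blast
      then have "e s = (\<Sum>t<n. A s t * (\<zeta> * k t)) - (\<Sum>t<n. A s t * (\<zeta> * (\<Sum>j\<in>UNIV. K \<zeta> t j * u $ j)))"
        unfolding e_def using Kv[OF \<zeta> that, of u] by simp
      then show ?thesis
        by (simp add: e_def matvec_on_def right_diff_distrib sum_subtractf sum_distrib_left mult_ac)
    qed
    have "normsq_on {..<n} e = normsq_on {..<n} (\<lambda>s. \<zeta> * matvec_on {..<n} A e s)"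
      by (rule normsq_on_cong) (use e in auto)
    also have "\<dots> = (cmod \<zeta>)\<^sup>2 * normsq_on {..<n} (matvec_on {..<n} A e)"
      by (simp add: normsq_on_def norm_mult power_mult_distrib sum_distrib_left)
    also have "\<dots> \<le> (cmod \<zeta>)\<^sup>2 * normsq_on {..<n} e"
      by (intro mult_left_mono A) simp
    finally have "(1 - (cmod \<zeta>)\<^sup>2) * normsq_on {..<n} e \<le> 0"
      by (simp add: algebra_simps)
    moreover have "0 < 1 - (cmod \<zeta>)\<^sup>2"
      using \<zeta> by (simp add: power_less_one_iff)
    ultimately have "normsq_on {..<n} e = 0"
      using normsq_on_nonneg[of "{..<n}" e] by (simp add: mult_le_0_iff)
    then show ?thesis
      using \<open>s < n\<close> by (simp add: normsq_on_eq_0 e_def)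
  qed
  have right: "T \<zeta> *v u = v" if \<zeta>: "cmod \<zeta> < 1" and RN: "right_node U n \<zeta> k u v" for \<zeta> k u v
  proof -
    have "(T \<zeta> *v u) $ i = v $ i" for i
    proof -
      have "v $ i = (\<Sum>t<n. C i t * (\<zeta> * k t)) + (\<Sum>j\<in>UNIV. D i j * u $ j)"
        using RN unfolding right_node_def blocks by blast
      then show ?thesis
        by (simp add: Tv kK[OF \<zeta> RN])
    qed
    then show ?thesis
      by (simp add: Finite_Cartesian_Product.vec_eq_iff)
  qed
  \<comment> \<open>In matrix form \<open>T' = C (K + \<zeta> K')\<close> and
    \<open>K' = A (K + \<zeta> K')\<close>, so \<open>(1 - \<zeta> A) (K + \<zeta> K') = K\<close>.
    With \<open>x C = l (1 - \<zeta> A)\<close> this gives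
    \<open>x T' u = l K u = l k\<close>.\<close>
  have deriv: "scalar_product x (mat_deriv T \<zeta> *v u) = (\<Sum>s<n. l s * k s)"
    if \<zeta>: "cmod \<zeta> < 1" and LN: "left_node U n \<zeta> l x y" and RN: "right_node U n \<zeta> k u v" for \<zeta> l x y k u v
  proof -
    have in_ball: "\<zeta> \<in> ball 0 1"
      using \<zeta> by simp
    define K' where "K' s j = deriv (\<lambda>\<zeta>. K \<zeta> s j) \<zeta>" for s j
    have dK: "((\<lambda>\<zeta>. K \<zeta> s j) has_field_derivative K' s j) (at \<zeta>)" if "s < n" for s j
      unfolding K'_def using K_hol[OF that] open_ball in_ball by (rule holomorphic_derivI)
    have K': "K' s j = (\<Sum>t<n. A s t * K \<zeta> t j) + \<zeta> * (\<Sum>t<n. A s t * K' t j)" if "s < n" for s j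
    proof (rule DERIV_unique[OF dK[OF that]])
      have "((\<lambda>\<zeta>. B s j + \<zeta> * (\<Sum>t<n. A s t * K \<zeta> t j)) has_field_derivative
          (\<Sum>t<n. A s t * K \<zeta> t j) + \<zeta> * (\<Sum>t<n. A s t * K' t j)) (at \<zeta>)"
        by (auto intro!: derivative_eq_intros dK simp: mult.commute)
      then show "((\<lambda>\<zeta>. K \<zeta> s j) has_field_derivative
          (\<Sum>t<n. A s t * K \<zeta> t j) + \<zeta> * (\<Sum>t<n. A s t * K' t j)) (at \<zeta>)"
        by (rule has_field_derivative_transform_within_open[OF _ open_ball in_ball])
          (simp add: K[OF _ that, symmetric])
    qed
    have dT: "mat_deriv T \<zeta> $ i $ j = (\<Sum>s<n. C i s * (K \<zeta> s j + \<zeta> * K' s j))" for i j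
    proof -
      have "((\<lambda>\<zeta>. T \<zeta> $ i $ j) has_field_derivative
          (\<Sum>s<n. C i s * K \<zeta> s j) + \<zeta> * (\<Sum>s<n. C i s * K' s j)) (at \<zeta>)"
        unfolding T_def by (auto intro!: derivative_eq_intros dK simp: mult.commute)
      then show ?thesis
        by (simp add: mat_deriv_def DERIV_imp_deriv algebra_simps sum.distrib sum_distrib_left)
    qed
    have xT: "(\<Sum>i\<in>UNIV. x $ i * mat_deriv T \<zeta> $ i $ j) = (\<Sum>s<n. l s * K \<zeta> s j)" for j
    proof -
      have "(\<Sum>i\<in>UNIV. x $ i * mat_deriv T \<zeta> $ i $ j) =
          (\<Sum>i\<in>UNIV. \<Sum>s<n. x $ i * C i s * (K \<zeta> s j + \<zeta> * K' s j))"
        by (simp add: dT sum_distrib_left mult_ac)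
      also have "\<dots> = (\<Sum>s<n. \<Sum>i\<in>UNIV. x $ i * C i s * (K \<zeta> s j + \<zeta> * K' s j))"
        by (rule sum.swap)
      also have "\<dots> = (\<Sum>s<n. (\<Sum>i\<in>UNIV. x $ i * C i s) * (K \<zeta> s j + \<zeta> * K' s j))"
        by (simp add: sum_distrib_right)
      also have "\<dots> = (\<Sum>s<n. l s * (K \<zeta> s j + \<zeta> * K' s j - \<zeta> * (\<Sum>t<n. A s t * (K \<zeta> t j + \<zeta> * K' t j))))"
        by (rule xC[OF LN])
      also have "\<dots> = (\<Sum>s<n. l s * K \<zeta> s j)"
      proof (intro sum.cong refl arg_cong2[of _ _ _ _ "(*)"])
        fix s assume "s \<in> {..<n}"
        then have "K' s j = (\<Sum>t<n. A s t * (K \<zeta> t j + \<zeta> * K' t j))"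
          using K'[of s j] by (simp add: algebra_simps sum.distrib sum_distrib_left)
        then show "K \<zeta> s j + \<zeta> * K' s j - \<zeta> * (\<Sum>t<n. A s t * (K \<zeta> t j + \<zeta> * K' t j)) = K \<zeta> s j"
          by simp
      qed
      finally show ?thesis .
    qed
    have "scalar_product x (mat_deriv T \<zeta> *v u) = (\<Sum>i\<in>UNIV. \<Sum>j\<in>UNIV. x $ i * mat_deriv T \<zeta> $ i $ j * u $ j)"
      by (simp add: scalar_product_def matrix_vector_mult_def sum_distrib_left mult_ac)
    also have "\<dots> = (\<Sum>j\<in>UNIV. \<Sum>i\<in>UNIV. x $ i * mat_deriv T \<zeta> $ i $ j * u $ j)"
      by (rule sum.swap)
    also have "\<dots> = (\<Sum>j\<in>UNIV. (\<Sum>s<n. l s * K \<zeta> s j) * u $ j)"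
      by (simp add: xT flip: sum_distrib_right)
    also have "\<dots> = (\<Sum>j\<in>UNIV. \<Sum>s<n. l s * (K \<zeta> s j * u $ j))"
      by (simp add: sum_distrib_right mult.assoc)
    also have "\<dots> = (\<Sum>s<n. \<Sum>j\<in>UNIV. l s * (K \<zeta> s j * u $ j))"
      by (rule sum.swap)
    also have "\<dots> = (\<Sum>s<n. l s * k s)"
      by (intro sum.cong refl) (simp add: kK[OF \<zeta> RN] sum_distrib_left)
    finally show ?thesis .
  qed
  show thesis
    by (rule that[OF T_hol _ left right deriv]) (auto intro!: onorm_bound T_norm)
qed

section \<open>The Pick form of a disc\<close>

text \<open>The form \<open>x\<^sup>* y\<close> is conjugate linear in its first argument, whereas
  \<open>inner_on\<close> is so in its second; hence the indices swap when the two meet.\<close>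

definition herm :: "complex ^ 'n \<Rightarrow> complex ^ 'n \<Rightarrow> complex" where
  "herm x y = scalar_product (cnj_vec x) y"

lemma herm_altdef: "herm x y = (\<Sum>i\<in>UNIV. cnj (x $ i) * y $ i)"
  by (simp add: herm_def scalar_product_def cnj_vec_def)

lemma herm_self: "herm x x = complex_of_real ((norm x)\<^sup>2)"
  by (simp add: herm_altdef norm_vec_def L2_set_def sum_nonneg complex_norm_square mult.commute
      del: of_real_power)

lemma cnj_herm: "cnj (herm x y) = herm y x"
  by (simp add: herm_altdef mult.commute)

lemma herm_diff_left: "herm (x - y) z = herm x z - herm y z"
  by (simp add: herm_altdef left_diff_distrib sum_subtractf)

lemma herm_diff_right: "herm x (y - z) = herm x y - herm x z"
  by (simp add: herm_altdef right_diff_distrib sum_subtractf)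

lemma herm_sum:
  "herm (\<Sum>k\<in>A. \<gamma> k *s e k) (\<Sum>l\<in>B. \<delta> l *s g l) = (\<Sum>k\<in>A. \<Sum>l\<in>B. cnj (\<gamma> k) * \<delta> l * herm (e k) (g l))"
proof -
  have "herm (\<Sum>k\<in>A. \<gamma> k *s e k) (\<Sum>l\<in>B. \<delta> l *s g l) =
      (\<Sum>i\<in>UNIV. \<Sum>k\<in>A. \<Sum>l\<in>B. (cnj (\<gamma> k) * cnj (e k $ i)) * (\<delta> l * g l $ i))"
    by (simp add: herm_altdef sum_product)
  also have "\<dots> = (\<Sum>k\<in>A. \<Sum>i\<in>UNIV. \<Sum>l\<in>B. (cnj (\<gamma> k) * cnj (e k $ i)) * (\<delta> l * g l $ i))"
    by (rule sum.swap)
  also have "\<dots> = (\<Sum>k\<in>A. \<Sum>l\<in>B. \<Sum>i\<in>UNIV. (cnj (\<gamma> k) * cnj (e k $ i)) * (\<delta> l * g l $ i))"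
    by (intro sum.cong refl sum.swap)
  finally show ?thesis
    by (simp add: herm_altdef sum_distrib_left mult_ac)
qed

lemma matrix_vector_mult_sum: "(M :: complex ^ 'm ^ 'p) *v (\<Sum>k\<in>A. \<gamma> k *s f k) = (\<Sum>k\<in>A. \<gamma> k *s (M *v f k))"
  by (induction A rule: infinite_finite_induct)
     (simp_all add: matrix_vector_right_distrib vector_scalar_commute)

lemma scalar_product_matrix_assoc:
  fixes M :: "complex ^ 'm ^ 'p"
  shows "scalar_product (x v* M) u = scalar_product x (M *v u)"
proof -
  have "scalar_product (x v* M) u = (\<Sum>j\<in>UNIV. \<Sum>i\<in>UNIV. x $ i * M $ i $ j * u $ j)"
    by (simp add: scalar_product_def vector_matrix_mult_def sum_distrib_right)
  also have "\<dots> = (\<Sum>i\<in>UNIV. \<Sum>j\<in>UNIV. x $ i * M $ i $ j * u $ j)"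
    by (rule sum.swap)
  also have "\<dots> = scalar_product x (M *v u)"
    by (simp add: scalar_product_def matrix_vector_mult_def sum_distrib_left mult_ac)
  finally show ?thesis .
qed

text \<open>The confluent value at \<open>a = b\<close> lets one formula describe the mixed block of
  the Pick matrix at distinct and at coinciding nodes.\<close>

definition divided_difference :: "(complex \<Rightarrow> complex) \<Rightarrow> complex \<Rightarrow> complex \<Rightarrow> complex" where
  "divided_difference h a b = (if a = b then deriv h a else (h b - h a) / (b - a))"

section \<open>Cauchy integrals over the unit circle\<close>

lemma circle_mean_Cauchy:
  fixes h :: "complex \<Rightarrow> complex"
  assumes "h holomorphic_on cball 0 1" "cmod a < 1"
  shows "((\<lambda>t. cis t * h (cis t) / (cis t - a)) has_integral 2 * pi * h a) {0..2*pi}"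
proof -
  have "((\<lambda>u. h u / (u - a)) has_contour_integral 2 * pi * \<i> * h a) (part_circlepath 0 1 0 (2*pi))"
    using Cauchy_integral_circlepath_simple[OF assms(1), of a] assms(2) by (simp add: circlepath_def)
  then have "((\<lambda>t. h (cis t) / (cis t - a) * \<i> * cis t) has_integral 2 * pi * \<i> * h a) {0..2*pi}"
    by (subst (asm) has_contour_integral_part_circlepath_iff) simp_all
  from has_integral_mult_right[OF this, of "- \<i>"] show ?thesis
    by (simp add: mult_ac)
qed

lemma circle_mean_0:
  fixes h :: "complex \<Rightarrow> complex"
  assumes "h holomorphic_on cball 0 1"
  shows "((\<lambda>t. cis t * h (cis t)) has_integral 0) {0..2*pi}"
proof -
  have "(\<lambda>z. z * h z) holomorphic_on cball 0 1"
    by (intro holomorphic_intros assms)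
  from circle_mean_Cauchy[OF this, of 0] show ?thesis
    by simp
qed

lemma one_minus_cnj_mult_nonzero:
  assumes "cmod a < 1" "cmod z \<le> 1"
  shows "1 - cnj a * z \<noteq> 0"
proof
  assume "1 - cnj a * z = 0"
  then have "cmod a * cmod z = 1"
    by (metis complex_mod_cnj eq_iff_diff_eq_0 norm_mult norm_one)
  moreover have "cmod a * cmod z \<le> cmod a * 1"
    by (intro mult_left_mono assms) simp
  ultimately show False
    using assms(1) by linarith
qed

text \<open>On the unit circle, conjugation is inversion. This identity and the next exchange a
  Szego kernel, holomorphic on the closed disc when \<open>cmod a < 1\<close>, with a kernel that
  has its pole at \<open>a\<close>.\<close>

lemma cnj_szego_kernel_cis: "cnj (1 / (1 - cnj a * cis t)) = cis t / (cis t - a)"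
proof -
  have "cnj (cis t) * cis t = 1"
    by (simp add: cis_cnj cis_mult)
  then show ?thesis
    by (simp add: cis_cnj field_simps cis_inverse[symmetric])
qed

lemma cnj_pole_cis: "cnj (1 / (cis t - a)) = cis t / (1 - cnj a * cis t)"
proof -
  have "cis t * (cnj (cis t) - cnj a) = 1 - cnj a * cis t"
    by (simp add: right_diff_distrib cis_cnj cis_mult)
  then have "cis t / (1 - cnj a * cis t) = cis t / (cis t * (cnj (cis t) - cnj a))"
    by simp
  then show ?thesis
    by simp
qed

text \<open>Subtracting \<open>h b\<close> removes the pole at \<open>b\<close>: Cauchy's formula
  for the quotient \<open>q\<close> yields \<open>q a\<close>, and the remaining constant multiple
  of the double kernel has mean 0. No partial fractions occur, so \<open>a = b\<close> needs no
  separate treatment of the integral.\<close>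

lemma circle_mean_two_poles:
  assumes "h holomorphic_on A" "open A" "cball 0 1 \<subseteq> A" "cmod a < 1" "cmod b < 1"
  shows "((\<lambda>t. cis t * h (cis t) / ((cis t - a) * (cis t - b))) has_integral
           2 * pi * divided_difference h a b) {0..2*pi}"
proof -
  define g where "g z = 1 / ((1 - cnj a * z) * (1 - cnj b * z))" for z
  define q where "q z = (if z = b then deriv h b else (h z - h b) / (z - b))" for z
  have "q holomorphic_on A"
    unfolding q_def using pole_lemma_open[OF assms(1,2)] by simp
  then have q: "q holomorphic_on cball 0 1"
    using assms(3) by (rule holomorphic_on_subset)
  have nz: "cis t - a \<noteq> 0" "cis t - b \<noteq> 0" for t
    using assms(4,5) by (metis eq_iff_diff_eq_0 less_irrefl norm_cis)+
  \<comment> \<open>The double kernel is the conjugate on the circle of \<open>z * g z\<close>,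
    whose mean is its value 0 at the centre.\<close>
  have "g holomorphic_on cball 0 1"
    unfolding g_def using assms(4,5)
    by (intro holomorphic_intros) (auto dest!: one_minus_cnj_mult_nonzero)
  from circle_mean_0[OF this]
  have "((\<lambda>t. cnj (cis t * g (cis t))) has_integral 0) {0..2*pi}"
    by (subst (asm) has_integral_cnj[symmetric]) (simp add: o_def)
  also have "(\<lambda>t. cnj (cis t * g (cis t))) = (\<lambda>t. cis t / ((cis t - a) * (cis t - b)))"
  proof
    fix t
    have "cnj (cis t * g (cis t)) = cnj (cis t) * (cnj (1 / (1 - cnj a * cis t)) * cnj (1 / (1 - cnj b * cis t)))"
      by (simp add: g_def)
    also have "\<dots> = (cnj (cis t) * cis t) * cis t / ((cis t - a) * (cis t - b))"
      unfolding cnj_szego_kernel_cis by simp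
    also have "cnj (cis t) * cis t = 1"
      by (simp add: cis_cnj cis_mult)
    finally show "cnj (cis t * g (cis t)) = cis t / ((cis t - a) * (cis t - b))"
      by simp
  qed
  finally have "((\<lambda>t. cis t * q (cis t) / (cis t - a) + h b * (cis t / ((cis t - a) * (cis t - b))))
      has_integral 2 * pi * q a + h b * 0) {0..2*pi}"
    by (intro has_integral_add has_integral_mult_right circle_mean_Cauchy[OF q] assms)
  also have "(\<lambda>t. cis t * q (cis t) / (cis t - a) + h b * (cis t / ((cis t - a) * (cis t - b)))) =
      (\<lambda>t. cis t * h (cis t) / ((cis t - a) * (cis t - b)))"
  proof
    fix t
    have h: "h (cis t) = (cis t - b) * q (cis t) + h b"
      using nz(2)[of t] by (auto simp: q_def)
    have "z * Q / d1 + H * (z / (d1 * d2)) = z * (d2 * Q + H) / (d1 * d2)"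
      if "d1 \<noteq> 0" "d2 \<noteq> 0" for z Q H d1 d2 :: complex
      using that by (simp add: field_simps)
    then show "cis t * q (cis t) / (cis t - a) + h b * (cis t / ((cis t - a) * (cis t - b))) =
        cis t * h (cis t) / ((cis t - a) * (cis t - b))"
      using nz[of t] unfolding h by blast
  qed
  also have "q a = divided_difference h a b"
    using minus_divide_divide[of "h a - h b" "a - b"] by (auto simp: q_def divided_difference_def)
  finally show ?thesis
    by simp
qed

text \<open>Pointwise on the unit circle, the integrand below is a positive semidefinite Hermitian form,
  because \<open>T\<close> is contractive; its mean over the circle is the Pick matrix.\<close>

lemma pick_form_nonneg_disc:
  fixes T :: "complex \<Rightarrow> complex ^ 'm ^ 'p"
    and e :: "nat \<Rightarrow> complex ^ 'p" and f :: "nat \<Rightarrow> complex ^ 'm"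
  defines "s k l \<equiv> \<lambda>\<zeta>. herm (e k) (T \<zeta> *v f l)"
  assumes A: "open A" "cball 0 1 \<subseteq> A"
    and T_hol: "\<And>i j. (\<lambda>\<zeta>. T \<zeta> $ i $ j) holomorphic_on A"
    and T_norm: "\<And>\<zeta> b. cmod \<zeta> = 1 \<Longrightarrow> norm (T \<zeta> *v b) \<le> norm b"
    and a: "\<And>k. k < n \<Longrightarrow> cmod (a k) < 1"
    and left: "\<And>k. k < n \<Longrightarrow> k \<in> L \<Longrightarrow> cnj_vec (e k) v* T (a k) = cnj_vec (f k)"
    and right: "\<And>k. k < n \<Longrightarrow> k \<notin> L \<Longrightarrow> T (a k) *v f k = e k"
    and LL: "\<And>k l. k < n \<Longrightarrow> l < n \<Longrightarrow> k \<in> L \<Longrightarrow> l \<in> L \<Longrightarrow>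
        P k l = (herm (e k) (e l) - herm (f k) (f l)) / (1 - a k * cnj (a l))"
    and RR: "\<And>k l. k < n \<Longrightarrow> l < n \<Longrightarrow> k \<notin> L \<Longrightarrow> l \<notin> L \<Longrightarrow>
        P k l = (herm (f k) (f l) - herm (e k) (e l)) / (1 - cnj (a k) * a l)"
    and LR: "\<And>k l. k < n \<Longrightarrow> l < n \<Longrightarrow> k \<in> L \<Longrightarrow> l \<notin> L \<Longrightarrow>
        P k l = - divided_difference (s k l) (a k) (a l)"
    and RL: "\<And>k l. k < n \<Longrightarrow> l < n \<Longrightarrow> k \<notin> L \<Longrightarrow> l \<in> L \<Longrightarrow> P k l = cnj (P l k)"
  shows "0 \<le> Re (\<Sum>k<n. \<Sum>l<n. cnj (c k) * P k l * c l)"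
proof -
  \<comment> \<open>The kernels are chosen so that \<open>cnj (\<kappa> k) * \<kappa> l\<close> has
    poles exactly at nodes where the data are known: at \<open>a k\<close> for two left nodes, at
    \<open>a l\<close> for two right nodes, at both for left and right, and nowhere for right and
    left. \<open>J\<close> collects the resulting means.\<close>
  define \<kappa> where "\<kappa> k \<zeta> = (if k \<in> L then 1 / (1 - cnj (a k) * \<zeta>) else 1 / (\<zeta> - a k))" for k \<zeta>
  define J where "J h k l = (if k \<in> L then if l \<in> L then h (a k) / (1 - cnj (a l) * a k)
      else divided_difference h (a k) (a l)
      else if l \<in> L then 0 else h (a l) / (1 - cnj (a k) * a l))" for h k l
  have nz: "1 - cnj (a k) * \<zeta> \<noteq> 0" if "k < n" "cmod \<zeta> \<le> 1" for k \<zeta>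
    using one_minus_cnj_mult_nonzero[OF a] that by blast
  have cnj_\<kappa>: "cnj (\<kappa> k (cis t)) = (if k \<in> L then cis t / (cis t - a k) else cis t / (1 - cnj (a k) * cis t))"
    for k t
    using cnj_szego_kernel_cis[of "a k" t] cnj_pole_cis[of t "a k"] by (simp add: \<kappa>_def)
  have J: "((\<lambda>t. cnj (\<kappa> k (cis t)) * \<kappa> l (cis t) * h (cis t)) has_integral 2 * pi * J h k l) {0..2*pi}"
    if k: "k < n" and l: "l < n" and h: "h holomorphic_on A" for k l h
  proof -
    have h1: "h holomorphic_on cball 0 1"
      using h A(2) by (rule holomorphic_on_subset)
    have kern: "(\<lambda>z. h z / (1 - cnj (a k) * z)) holomorphic_on cball 0 1" if "k < n" for k
      using nz[OF that] by (intro holomorphic_intros h1) auto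
    consider "k \<in> L" "l \<in> L" | "k \<in> L" "l \<notin> L" | "k \<notin> L" "l \<in> L" | "k \<notin> L" "l \<notin> L"
      by blast
    then show ?thesis
    proof cases
      case 1
      show ?thesis
        using circle_mean_Cauchy[OF kern[OF l] a[OF k]] 1
        unfolding cnj_\<kappa> by (simp add: \<kappa>_def J_def mult_ac)
    next
      case 2
      show ?thesis
        using circle_mean_two_poles[OF h A a[OF k] a[OF l]] 2
        unfolding cnj_\<kappa> by (simp add: \<kappa>_def J_def mult_ac)
    next
      case 3
      have "(\<lambda>z. h z / (1 - cnj (a k) * z) / (1 - cnj (a l) * z)) holomorphic_on cball 0 1"
        using nz[OF l] by (intro holomorphic_intros kern k) auto
      from circle_mean_0[OF this] show ?thesis
        using 3 unfolding cnj_\<kappa> by (simp add: \<kappa>_def J_def mult_ac)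
    next
      case 4
      show ?thesis
        using circle_mean_Cauchy[OF kern[OF k] a[OF l]] 4
        unfolding cnj_\<kappa> by (simp add: \<kappa>_def J_def mult_ac)
    qed
  qed
  have s_hol: "s k l holomorphic_on A" for k l
    unfolding s_def herm_altdef matrix_vector_mult_def using T_hol
    by (auto intro!: holomorphic_intros)
  have s_left: "s k l (a k) = herm (f k) (f l)" if "k < n" "k \<in> L" for k l
    unfolding s_def herm_def scalar_product_matrix_assoc[symmetric] left[OF that] ..
  have s_right: "s k l (a l) = herm (e k) (e l)" if "l < n" "l \<notin> L" for k l
    unfolding s_def right[OF that] ..
  \<comment> \<open>The matrix of the form in the coefficients \<open>c\<close>; its last term is
    the conjugate of the preceding one with \<open>k\<close> and \<open>l\<close> exchanged, which
    makes it Hermitian.\<close>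
  define G where "G k l t = cnj (\<kappa> k (cis t)) * \<kappa> l (cis t) * (herm (e k) (e l) + herm (f k) (f l))
      - cnj (\<kappa> k (cis t)) * \<kappa> l (cis t) * s k l (cis t)
      - cnj (cnj (\<kappa> l (cis t)) * \<kappa> k (cis t) * s l k (cis t))" for k l t
  have G: "(G k l has_integral 2 * pi * P k l) {0..2*pi}" if k: "k < n" and l: "l < n" for k l
  proof -
    have "(G k l has_integral 2 * pi * J (\<lambda>_. herm (e k) (e l) + herm (f k) (f l)) k l
        - 2 * pi * J (s k l) k l - cnj (2 * pi * J (s l k) l k)) {0..2*pi}"
      unfolding G_def
      by (intro has_integral_diff J k l s_hol holomorphic_on_const
          has_integral_cnj[THEN iffD2, unfolded o_def])
    also have "2 * pi * J (\<lambda>_. herm (e k) (e l) + herm (f k) (f l)) k l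
        - 2 * pi * J (s k l) k l - cnj (2 * pi * J (s l k) l k) = 2 * pi * P k l"
    proof -
      consider "k \<in> L" "l \<in> L" | "k \<in> L" "l \<notin> L" | "k \<notin> L" "l \<in> L" | "k \<notin> L" "l \<notin> L"
        by blast
      \<comment> \<open>Within a diagonal block both \<open>s\<close> terms evaluate to the same
        Gram entry and turn the sum into a difference. In the left-right block the constant has
        divided difference 0 and the conjugated term has no pole, so only the divided difference of
        \<open>s k l\<close> remains.\<close>
      then have "J (\<lambda>_. herm (e k) (e l) + herm (f k) (f l)) k l - J (s k l) k l - cnj (J (s l k) l k) = P k l"
      proof cases
        case 1
        then show ?thesis
          using k l by (simp add: J_def LL s_left cnj_herm mult.commute flip: diff_divide_distrib)
      next
        case 2
        then show ?thesis
          using k l by (simp add: J_def LR divided_difference_def)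
      next
        case 3
        then show ?thesis
          using k l by (simp add: J_def LR RL)
      next
        case 4
        then show ?thesis
          using k l by (simp add: J_def RR s_right cnj_herm mult.commute flip: diff_divide_distrib)
      qed
      from arg_cong[OF this, of "\<lambda>x. 2 * pi * x"] show ?thesis
        by (simp add: right_diff_distrib)
    qed
    finally show ?thesis .
  qed
  have nonneg: "0 \<le> Re (\<Sum>k<n. \<Sum>l<n. cnj (c k) * G k l t * c l)" for t
  proof -
    define \<gamma> where "\<gamma> k = c k * \<kappa> k (cis t)" for k
    define x y where "x = (\<Sum>k<n. \<gamma> k *s e k)" and "y = (\<Sum>k<n. \<gamma> k *s f k)"
    define M where "M = T (cis t)"
    have xx: "herm x x = (\<Sum>k<n. \<Sum>l<n. cnj (\<gamma> k) * \<gamma> l * herm (e k) (e l))"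
      and yy: "herm y y = (\<Sum>k<n. \<Sum>l<n. cnj (\<gamma> k) * \<gamma> l * herm (f k) (f l))"
      and xy: "herm x (M *v y) = (\<Sum>k<n. \<Sum>l<n. cnj (\<gamma> k) * \<gamma> l * s k l (cis t))"
      by (simp_all add: x_def y_def matrix_vector_mult_sum herm_sum s_def M_def)
    have yx: "cnj (herm x (M *v y)) = (\<Sum>k<n. \<Sum>l<n. cnj (\<gamma> k) * \<gamma> l * cnj (s l k (cis t)))"
      unfolding xy by (subst sum.swap) (simp add: mult_ac)
    have "(\<Sum>k<n. \<Sum>l<n. cnj (c k) * G k l t * c l) =
        herm x x + herm y y - herm x (M *v y) - cnj (herm x (M *v y))"
      unfolding yx unfolding xx yy xy
      by (simp add: G_def \<gamma>_def algebra_simps sum.distrib sum_subtractf)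
    then have "Re (\<Sum>k<n. \<Sum>l<n. cnj (c k) * G k l t * c l) =
        (norm x)\<^sup>2 + (norm y)\<^sup>2 - 2 * Re (herm x (M *v y))"
      by (simp add: herm_self del: of_real_power)
    \<comment> \<open>Completing the square: the form equals the squared norm of
      \<open>x - M *v y\<close> plus the defect of \<open>M\<close> at \<open>y\<close>, and
      contractivity makes this defect nonnegative.\<close>
    moreover have "(norm (x - M *v y))\<^sup>2 = (norm x)\<^sup>2 - 2 * Re (herm x (M *v y)) + (norm (M *v y))\<^sup>2"
    proof -
      have "complex_of_real ((norm (x - M *v y))\<^sup>2) =
          herm x x - herm x (M *v y) - cnj (herm x (M *v y)) + herm (M *v y) (M *v y)"
        unfolding herm_self[symmetric] by (simp add: herm_diff_left herm_diff_right cnj_herm)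
      from arg_cong[OF this, of Re] show ?thesis
        by (simp add: herm_self del: of_real_power)
    qed
    moreover have "(norm (M *v y))\<^sup>2 \<le> (norm y)\<^sup>2"
      unfolding M_def by (intro power_mono T_norm) auto
    moreover have "0 \<le> (norm (x - M *v y))\<^sup>2"
      by simp
    ultimately show ?thesis
      by linarith
  qed
  have "((\<lambda>t. \<Sum>k<n. \<Sum>l<n. cnj (c k) * G k l t * c l) has_integral
      (\<Sum>k<n. \<Sum>l<n. cnj (c k) * (2 * pi * P k l) * c l)) {0..2*pi}"
    by (intro has_integral_sum has_integral_mult_left has_integral_mult_right G) auto
  then have "((\<lambda>t. Re (\<Sum>k<n. \<Sum>l<n. cnj (c k) * G k l t * c l)) has_integral
      Re (\<Sum>k<n. \<Sum>l<n. cnj (c k) * (2 * pi * P k l) * c l)) {0..2*pi}"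
    by (rule has_integral_Re)
  then have "0 \<le> Re (\<Sum>k<n. \<Sum>l<n. cnj (c k) * (2 * pi * P k l) * c l)"
    by (rule has_integral_nonneg) (rule nonneg)
  also have "(\<Sum>k<n. \<Sum>l<n. cnj (c k) * (2 * pi * P k l) * c l) =
      complex_of_real (2 * pi) * (\<Sum>k<n. \<Sum>l<n. cnj (c k) * P k l * c l)"
    by (simp add: sum_distrib_left mult_ac)
  finally show ?thesis
    by (simp add: zero_le_mult_iff pi_gt_zero[unfolded not_le[symmetric]] del: Re_sum)
qed

section \<open>The half plane\<close>

lemma schur_class_norm_le:
  fixes S :: "complex \<Rightarrow> complex ^ 'm ^ 'p"
  assumes "S \<in> schur_class" "z \<in> right_half_plane"
  shows "norm (S z *v b) \<le> norm b"
proof -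
  have "norm (S z *v b) \<le> onorm ((*v) (S z)) * norm b"
    by (rule onorm) (rule matrix_vector_mul_bounded_linear)
  also have "\<dots> \<le> 1 * norm b"
    using assms by (intro mult_right_mono) (auto simp: schur_class_def)
  finally show ?thesis
    by simp
qed

lemma open_right_half_plane: "open right_half_plane"
  unfolding right_half_plane_def by (rule open_halfspace_Re_gt)

lemma matrix_entry_has_field_derivative:
  fixes S :: "complex \<Rightarrow> complex ^ 'm ^ 'p"
  assumes "S \<in> schur_class" "z \<in> right_half_plane"
  shows "((\<lambda>z. S z $ i $ j) has_field_derivative mat_deriv S z $ i $ j) (at z)"
  using assms open_right_half_plane
  by (auto simp: schur_class_def mat_deriv_def intro: holomorphic_derivI)

lemma herm_matrix_has_field_derivative:
  fixes S :: "complex \<Rightarrow> complex ^ 'm ^ 'p"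
  assumes "S \<in> schur_class" "z \<in> right_half_plane"
  shows "((\<lambda>z. herm e (S z *v f)) has_field_derivative herm e (mat_deriv S z *v f)) (at z)"
  unfolding herm_altdef matrix_vector_mult_def
  by (auto intro!: derivative_eq_intros matrix_entry_has_field_derivative[OF assms] simp: mult.commute)

lemma divided_difference_affine:
  fixes c \<rho> :: complex
  assumes "\<rho> \<noteq> 0" "h field_differentiable at (c + \<rho> * a)"
  shows "divided_difference (\<lambda>\<zeta>. h (c + \<rho> * \<zeta>)) a b = \<rho> * divided_difference h (c + \<rho> * a) (c + \<rho> * b)"
proof (cases "a = b")
  case True
  have "(h has_field_derivative deriv h (c + \<rho> * a)) (at (c + \<rho> * a))"
    using assms(2) by (simp add: field_differentiable_derivI)
  then have "((\<lambda>\<zeta>. h (c + \<rho> * \<zeta>)) has_field_derivative deriv h (c + \<rho> * a) * \<rho>) (at a)"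
    by (rule DERIV_chain2) (auto intro!: derivative_eq_intros)
  then show ?thesis
    using True by (simp add: divided_difference_def DERIV_imp_deriv)
next
  case False
  have "c + \<rho> * b - (c + \<rho> * a) = \<rho> * (b - a)"
    by (simp add: algebra_simps)
  then show ?thesis
    using False assms(1) by (simp add: divided_difference_def)
qed

text \<open>The half plane is exhausted by the discs with centre \<open>1/\<epsilon>\<close> and radius \<open>1/\<epsilon> - \<epsilon>\<close>, whose
  normalized Pick matrices converge to the Pick matrix of the half plane as \<open>\<epsilon> \<rightarrow> 0\<close>.\<close>

lemma pick_form_nonneg_half_plane:
  fixes S :: "complex \<Rightarrow> complex ^ 'm ^ 'p"
    and e :: "nat \<Rightarrow> complex ^ 'p" and f :: "nat \<Rightarrow> complex ^ 'm"
  defines "s k l \<equiv> \<lambda>z. herm (e k) (S z *v f l)"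
  assumes S: "S \<in> schur_class"
    and p: "\<And>k. k < n \<Longrightarrow> p k \<in> right_half_plane"
    and left: "\<And>k. k < n \<Longrightarrow> k \<in> L \<Longrightarrow> cnj_vec (e k) v* S (p k) = cnj_vec (f k)"
    and right: "\<And>k. k < n \<Longrightarrow> k \<notin> L \<Longrightarrow> S (p k) *v f k = e k"
    and LL: "\<And>k l. k < n \<Longrightarrow> l < n \<Longrightarrow> k \<in> L \<Longrightarrow> l \<in> L \<Longrightarrow>
        P k l = (herm (e k) (e l) - herm (f k) (f l)) / (p k + cnj (p l))"
    and RR: "\<And>k l. k < n \<Longrightarrow> l < n \<Longrightarrow> k \<notin> L \<Longrightarrow> l \<notin> L \<Longrightarrow>
        P k l = (herm (f k) (f l) - herm (e k) (e l)) / (cnj (p k) + p l)"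
    and LR: "\<And>k l. k < n \<Longrightarrow> l < n \<Longrightarrow> k \<in> L \<Longrightarrow> l \<notin> L \<Longrightarrow>
        P k l = - divided_difference (s k l) (p k) (p l)"
    and RL: "\<And>k l. k < n \<Longrightarrow> l < n \<Longrightarrow> k \<notin> L \<Longrightarrow> l \<in> L \<Longrightarrow> P k l = cnj (P l k)"
  shows "0 \<le> Re (\<Sum>k<n. \<Sum>l<n. cnj (c k) * P k l * c l)"
proof -
  \<comment> \<open>The Pick matrix of the disc divided by \<open>R\<^sup>2 * E\<close>, with
    \<open>E\<close> and \<open>R\<close> as below; the normalization makes the limit at
    \<open>\<epsilon> = 0\<close> visible.\<close>
  define Q where "Q \<epsilon> k l =
      (if k \<in> L \<and> l \<in> L then (herm (e k) (e l) - herm (f k) (f l)) /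
          (p k + cnj (p l) - of_real \<epsilon> * (p k * cnj (p l) + 2 - of_real \<epsilon> ^ 2))
       else if k \<notin> L \<and> l \<notin> L then (herm (f k) (f l) - herm (e k) (e l)) /
          (cnj (p k) + p l - of_real \<epsilon> * (cnj (p k) * p l + 2 - of_real \<epsilon> ^ 2))
       else P k l / (1 - of_real \<epsilon> ^ 2))" for \<epsilon> :: real and k l
  have pos: "0 < Re (p k)" if "k < n" for k
    using p[OF that] by (simp add: right_half_plane_def)
  have Q_lim: "((\<lambda>\<epsilon>. Q \<epsilon> k l) \<longlongrightarrow> P k l) (at_right 0)" if k: "k < n" and l: "l < n" for k l
  proof -
    have nz: "p k + cnj (p l) \<noteq> 0" "cnj (p k) + p l \<noteq> 0"
      using pos[OF k] pos[OF l] by (auto simp: complex_eq_iff)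
    have \<epsilon>: "((\<lambda>\<epsilon>. complex_of_real \<epsilon>) \<longlongrightarrow> 0) (at_right 0)"
      by (intro tendsto_eq_intros) auto
    consider "k \<in> L" "l \<in> L" | "k \<notin> L" "l \<notin> L" | "(k \<in> L) \<noteq> (l \<in> L)"
      by blast
    then show ?thesis
    proof cases
      case 1
      then show ?thesis
        using nz unfolding Q_def LL[OF k l 1] by (auto intro!: tendsto_eq_intros \<epsilon>)
    next
      case 2
      then show ?thesis
        using nz unfolding Q_def RR[OF k l 2] by (auto intro!: tendsto_eq_intros \<epsilon>)
    next
      case 3
      then show ?thesis
        unfolding Q_def by (auto intro!: tendsto_eq_intros \<epsilon>)
    qed
  qed
  \<comment> \<open>For positive \<open>\<epsilon> < 1\<close>, expanding
    \<open>cmod (p k - 1 / \<epsilon>) < 1 / \<epsilon> - \<epsilon>\<close> shows that this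
    inequality places \<open>p k\<close> inside the disc.\<close>
  have "\<forall>\<^sub>F \<epsilon> in at_right 0. \<epsilon> * ((cmod (p k))\<^sup>2 + 2 - \<epsilon>\<^sup>2) < 2 * Re (p k)" if "k < n" for k
    by (rule order_tendstoD(2)[where y = 0]) (use pos[OF that] in \<open>auto intro!: tendsto_eq_intros\<close>)
  then have "\<forall>\<^sub>F \<epsilon> in at_right 0. \<forall>k\<in>{..<n}. \<epsilon> * ((cmod (p k))\<^sup>2 + 2 - \<epsilon>\<^sup>2) < 2 * Re (p k)"
    by (intro eventually_ball_finite) auto
  moreover have "\<forall>\<^sub>F \<epsilon>::real in at_right 0. \<epsilon> \<in> {0<..<1}"
    by (rule eventually_at_right_real) simp
  ultimately have "\<forall>\<^sub>F \<epsilon> in at_right 0. 0 \<le> Re (\<Sum>k<n. \<Sum>l<n. cnj (c k) * Q \<epsilon> k l * c l)"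
  proof eventually_elim
    case (elim \<epsilon>)
    \<comment> \<open>\<open>R\<close> is the radius \<open>1 / \<epsilon> - \<epsilon>\<close> of
      the disc, and \<open>a k\<close> is the node \<open>p k\<close> carried to the unit
      disc.\<close>
    define E R where "E = complex_of_real \<epsilon>" and "R = (1 - E\<^sup>2) / E"
    define r where "r = (1 - \<epsilon>\<^sup>2) / \<epsilon>"
    define a where "a k = (p k - 1 / E) / R" for k
    define T where "T \<zeta> = S (1 / E + R * \<zeta>)" for \<zeta>
    have \<epsilon>: "0 < \<epsilon>" "\<epsilon>\<^sup>2 < 1"
      using elim by (auto simp: power_less_one_iff)
    have R: "R = complex_of_real r"
      by (simp add: R_def E_def r_def)
    have r: "0 < r" "r < 1 / \<epsilon>"
      using \<epsilon> by (auto simp: r_def field_simps)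
    have one: "1 < 1 / (\<epsilon> * r)"
      using r \<epsilon> by (simp add: field_simps)
    have nz: "E \<noteq> 0" "R \<noteq> 0"
      using \<epsilon> r by (auto simp: E_def R)
    have pa: "1 / E + R * a k = p k" for k
      using nz by (simp add: a_def)
    \<comment> \<open>The radius \<open>r\<close> is smaller than \<open>1 / \<epsilon>\<close>, so
      a disc of radius larger than 1 still lands in the half plane and \<open>T\<close> is
      holomorphic beyond the closed unit disc.\<close>
    have half_plane: "1 / E + R * \<zeta> \<in> right_half_plane" if "\<zeta> \<in> ball 0 (1 / (\<epsilon> * r))" for \<zeta>
    proof -
      have "- Re (R * \<zeta>) \<le> r * cmod \<zeta>"
        using abs_Re_le_cmod[of "R * \<zeta>"] r by (simp add: R norm_mult)
      also have "\<dots> < r * (1 / (\<epsilon> * r))"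
        using that r by (intro mult_strict_left_mono) auto
      also have "\<dots> = Re (1 / E)"
        using \<epsilon> r by (simp add: E_def flip: of_real_divide of_real_inverse)
      finally show ?thesis
        by (simp add: right_half_plane_def)
    qed
    have den: "1 - a k * cnj (a l) = (p k + cnj (p l) - E * (p k * cnj (p l) + 2 - E\<^sup>2)) / (R\<^sup>2 * E)" for k l
    proof -
      have cR: "cnj R = R" "cnj E = E"
        by (simp_all add: R E_def)
      have "1 - a k * cnj (a l) = (R\<^sup>2 - (p k - 1 / E) * (cnj (p l) - 1 / E)) / R\<^sup>2"
        using nz by (simp add: a_def cR field_simps power2_eq_square)
      also have "R\<^sup>2 - (p k - 1 / E) * (cnj (p l) - 1 / E) =
          (p k + cnj (p l) - E * (p k * cnj (p l) + 2 - E\<^sup>2)) / E"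
        unfolding R_def using nz(1) by (simp add: field_simps power2_eq_square)
      finally show ?thesis
        by (simp add: mult.commute)
    qed
    have "0 \<le> Re (\<Sum>k<n. \<Sum>l<n. cnj (c k) * (R\<^sup>2 * E * Q \<epsilon> k l) * c l)"
    proof (rule pick_form_nonneg_disc[where T = T and e = e and f = f and a = a and L = L])
      show "open (ball (0::complex) (1 / (\<epsilon> * r)))"
        by simp
      show "cball 0 1 \<subseteq> ball (0::complex) (1 / (\<epsilon> * r))"
        using one by auto
      show "norm (T \<zeta> *v b) \<le> norm b" if "cmod \<zeta> = 1" for \<zeta> b
        unfolding T_def using that one by (intro schur_class_norm_le[OF S] half_plane) auto
      show "(\<lambda>\<zeta>. T \<zeta> $ i $ j) holomorphic_on ball 0 (1 / (\<epsilon> * r))" for i j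
      proof -
        have "(\<lambda>z. S z $ i $ j) holomorphic_on right_half_plane"
          using S by (simp add: schur_class_def)
        then have "((\<lambda>z. S z $ i $ j) \<circ> (\<lambda>\<zeta>. 1 / E + R * \<zeta>)) holomorphic_on ball 0 (1 / (\<epsilon> * r))"
          by (rule holomorphic_on_compose_gen[rotated]) (auto intro!: holomorphic_intros half_plane)
        then show ?thesis
          by (simp add: T_def o_def)
      qed
      show "cmod (a k) < 1" if "k < n" for k
      proof -
        have "complex_of_real (1 - (cmod (a k))\<^sup>2) = 1 - a k * cnj (a k)"
          by (simp add: complex_norm_square del: of_real_power)
        also have "\<dots> = complex_of_real ((2 * Re (p k) - \<epsilon> * ((cmod (p k))\<^sup>2 + 2 - \<epsilon>\<^sup>2)) / (r\<^sup>2 * \<epsilon>))"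
          unfolding den R E_def by (simp add: complex_add_cnj complex_norm_square[symmetric])
        finally have "1 - (cmod (a k))\<^sup>2 = (2 * Re (p k) - \<epsilon> * ((cmod (p k))\<^sup>2 + 2 - \<epsilon>\<^sup>2)) / (r\<^sup>2 * \<epsilon>)"
          by (simp only: of_real_eq_iff)
        also have "\<dots> > 0"
          using elim that \<epsilon> r by (intro divide_pos_pos) auto
        finally show ?thesis
          by (simp add: power_less_one_iff)
      qed
      show "cnj_vec (e k) v* T (a k) = cnj_vec (f k)" if "k < n" "k \<in> L" for k
        using left[OF that] by (simp add: T_def pa)
      show "T (a k) *v f k = e k" if "k < n" "k \<notin> L" for k
        using right[OF that] by (simp add: T_def pa)
      show "R\<^sup>2 * E * Q \<epsilon> k l = (herm (e k) (e l) - herm (f k) (f l)) / (1 - a k * cnj (a l))"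
        if "k \<in> L" "l \<in> L" for k l
        using that unfolding den by (simp add: Q_def E_def)
      show "R\<^sup>2 * E * Q \<epsilon> k l = (herm (f k) (f l) - herm (e k) (e l)) / (1 - cnj (a k) * a l)"
        if "k \<notin> L" "l \<notin> L" for k l
        using that den[of l k] by (simp add: Q_def E_def mult.commute add.commute)
      \<comment> \<open>Rescaling by \<open>R\<close> multiplies a divided difference by
        \<open>R\<close>, by the chain rule in the confluent case;
        \<open>R * E = 1 - E\<^sup>2\<close> accounts for the denominator in
        \<open>Q\<close>.\<close>
      have Q_mixed: "R\<^sup>2 * E * Q \<epsilon> k l = R * P k l" if "(k \<in> L) \<noteq> (l \<in> L)" for k l
      proof -
        have "1 - E\<^sup>2 = R * E"
          using nz by (simp add: R_def)
        then show ?thesis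
          using that nz by (auto simp: Q_def E_def[symmetric] power2_eq_square)
      qed
      show "R\<^sup>2 * E * Q \<epsilon> k l = - divided_difference (\<lambda>\<zeta>. herm (e k) (T \<zeta> *v f l)) (a k) (a l)"
        if "k < n" "l < n" "k \<in> L" "l \<notin> L" for k l
      proof -
        have "divided_difference (\<lambda>\<zeta>. s k l (1 / E + R * \<zeta>)) (a k) (a l) = R * divided_difference (s k l) (p k) (p l)"
          using divided_difference_affine[of R "s k l" "1 / E" "a k" "a l"] nz(2)
            herm_matrix_has_field_derivative[OF S p[OF that(1)], of "e k" "f l"]
          unfolding pa s_def field_differentiable_def by blast
        then show ?thesis
          using Q_mixed[of k l] LR[OF that] that by (simp add: s_def T_def)
      qed
      show "R\<^sup>2 * E * Q \<epsilon> k l = cnj (R\<^sup>2 * E * Q \<epsilon> l k)"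
        if "k < n" "l < n" "k \<notin> L" "l \<in> L" for k l
        using Q_mixed[of k l] Q_mixed[of l k] RL[OF that] that by (simp add: R)
    qed
    also have "(\<Sum>k<n. \<Sum>l<n. cnj (c k) * (R\<^sup>2 * E * Q \<epsilon> k l) * c l) =
        complex_of_real (r\<^sup>2 * \<epsilon>) * (\<Sum>k<n. \<Sum>l<n. cnj (c k) * Q \<epsilon> k l * c l)"
      by (simp add: sum_distrib_left mult_ac R E_def)
    finally have "0 \<le> (r\<^sup>2 * \<epsilon>) * Re (\<Sum>k<n. \<Sum>l<n. cnj (c k) * Q \<epsilon> k l * c l)"
      by (simp del: Re_sum of_real_mult of_real_power)
    moreover have "0 < r\<^sup>2 * \<epsilon>"
      using \<epsilon> r by simp
    ultimately show ?case
      by (simp add: zero_le_mult_iff del: Re_sum)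
  qed
  moreover have "((\<lambda>\<epsilon>. Re (\<Sum>k<n. \<Sum>l<n. cnj (c k) * Q \<epsilon> k l * c l)) \<longlongrightarrow>
      Re (\<Sum>k<n. \<Sum>l<n. cnj (c k) * P k l * c l)) (at_right 0)"
    using Q_lim by (intro tendsto_intros) auto
  ultimately show ?thesis
    by (intro tendsto_lowerbound) auto
qed

text \<open>Where a left and a right node coincide, the Lyapunov coefficient vanishes and leaves
  \<open>P k l\<close> free; the free entry reappears, up to sign, as the tangential derivative of
  the interpolant.\<close>

lemma half_plane_interpolant:
  fixes e :: "nat \<Rightarrow> complex ^ 'p" and f :: "nat \<Rightarrow> complex ^ 'm"
  defines "\<tau> p L k \<equiv> if k \<in> L then cnj (p k) else - p k"
  assumes p: "\<And>k. k < n \<Longrightarrow> p k \<in> right_half_plane"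
    and lyapunov: "\<And>k l. k < n \<Longrightarrow> l < n \<Longrightarrow>
        (cnj (\<tau> p L k) + \<tau> p L l) * P k l = herm (e k) (e l) - herm (f k) (f l)"
    and P_herm: "\<And>k l. k < n \<Longrightarrow> l < n \<Longrightarrow> P l k = cnj (P k l)"
    and P_nonneg: "\<And>c. 0 \<le> Re (\<Sum>k<n. \<Sum>l<n. cnj (c k) * P k l * c l)"
  obtains S where "S \<in> schur_class"
    and "\<And>k. k < n \<Longrightarrow> k \<in> L \<Longrightarrow> cnj_vec (e k) v* S (p k) = cnj_vec (f k)"
    and "\<And>k. k < n \<Longrightarrow> k \<notin> L \<Longrightarrow> S (p k) *v f k = e k"
    and "\<And>k l. k < n \<Longrightarrow> l < n \<Longrightarrow> k \<in> L \<Longrightarrow> l \<notin> L \<Longrightarrow> p k = p l \<Longrightarrow>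
           herm (e k) (mat_deriv S (p k) *v f l) = - P k l"
proof -
  let ?I = "{..<n} <+> (UNIV :: 'm set)" and ?J = "{..<n} <+> (UNIV :: 'p set)"
  have P_nonneg': "0 \<le> Re (\<Sum>k<n. \<Sum>l<n. c k * P k l * cnj (c l))" for c
    using P_nonneg[of "\<lambda>k. cnj (c k)"] by simp
  have "\<exists>g. \<forall>k<n. \<forall>l<n. P k l = inner_on {..<n} (g k) (g l)"
    using P_herm P_nonneg' by (rule gram_factorization)
  then obtain g where g: "\<And>k l. k < n \<Longrightarrow> l < n \<Longrightarrow> P k l = inner_on {..<n} (g k) (g l)"
    by blast
  \<comment> \<open>Since \<open>(\<alpha> + 1/2) (\<beta> + 1/2) - (\<alpha> - 1/2) (\<beta> - 1/2)
    = \<alpha> + \<beta>\<close>, the Lyapunov equation is exactly the equality of the two Gram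
    matrices. Conjugating \<open>g\<close> gives the order \<open>P l k\<close> that matches
    \<open>herm (f l) (f k)\<close>.\<close>
  define d where "d k = case_sum (\<lambda>s. (\<tau> p L k + 1 / 2) * cnj (g k s)) (\<lambda>j. f k $ j)" for k
  define r where "r k = case_sum (\<lambda>s. (\<tau> p L k - 1 / 2) * cnj (g k s)) (\<lambda>i. e k $ i)" for k
  have gram: "inner_on ?I (d k) (d l) = inner_on ?J (r k) (r l)" if k: "k < n" and l: "l < n" for k l
  proof -
    have "inner_on ?I (d k) (d l) = (\<tau> p L k + 1 / 2) * (cnj (\<tau> p L l) + 1 / 2) * P l k + herm (f l) (f k)"
      unfolding g[OF l k] inner_on_def sum_Plus_UNIV herm_altdef
      by (simp add: d_def sum_distrib_left mult_ac)
    also have "\<dots> = (\<tau> p L k - 1 / 2) * (cnj (\<tau> p L l) - 1 / 2) * P l k + herm (e l) (e k)"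
      using lyapunov[OF l k] by (simp add: algebra_simps)
    also have "\<dots> = inner_on ?J (r k) (r l)"
      unfolding g[OF l k] inner_on_def sum_Plus_UNIV herm_altdef
      by (simp add: r_def sum_distrib_left mult_ac)
    finally show ?thesis .
  qed
  obtain U where Ud: "\<And>k j. k < n \<Longrightarrow> j \<in> ?J \<Longrightarrow> matvec_on ?I U (d k) j = r k j"
    and Ur: "\<And>k i. k < n \<Longrightarrow> i \<in> ?I \<Longrightarrow> matvec_on ?J (adj_mat U) (r k) i = d k i"
    and Uc: "\<And>h. normsq_on ?J (matvec_on ?I U h) \<le> normsq_on ?I h"
    by (rule lurking_isometry[of ?I ?J n d r]) (use gram in auto)
  obtain T :: "complex \<Rightarrow> complex ^ 'm ^ 'p"
    where T_hol: "\<And>i j. (\<lambda>\<zeta>. T \<zeta> $ i $ j) holomorphic_on ball 0 1"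
      and T_norm: "\<And>\<zeta>. cmod \<zeta> < 1 \<Longrightarrow> onorm ((*v) (T \<zeta>)) \<le> 1"
      and T_left: "\<And>\<zeta> l x y. cmod \<zeta> < 1 \<Longrightarrow> left_node U n \<zeta> l x y \<Longrightarrow> x v* T \<zeta> = y"
      and T_right: "\<And>\<zeta> k u v. cmod \<zeta> < 1 \<Longrightarrow> right_node U n \<zeta> k u v \<Longrightarrow> T \<zeta> *v u = v"
      and T_deriv: "\<And>\<zeta> l x y k u v. cmod \<zeta> < 1 \<Longrightarrow> left_node U n \<zeta> l x y \<Longrightarrow>
        right_node U n \<zeta> k u v \<Longrightarrow> scalar_product x (mat_deriv T \<zeta> *v u) = (\<Sum>s<n. l s * k s)"
    by (rule transfer_function[OF Uc]) blast
  \<comment> \<open>The shifts by \<open>1 / 2\<close> in \<open>d\<close> and \<open>r\<close>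
    dictate this Cayley transform: \<open>\<phi> z\<close> times \<open>z + 1 / 2\<close> is
    \<open>z - 1 / 2\<close>.\<close>
  define \<phi> where "\<phi> z = (z - 1 / 2) / (z + 1 / 2)" for z :: complex
  define S where "S z = T (\<phi> z)" for z
  have nz: "z + 1 / 2 \<noteq> 0" if "z \<in> right_half_plane" for z
    using that by (auto simp: right_half_plane_def complex_eq_iff)
  have \<phi>: "cmod (\<phi> z) < 1" if "z \<in> right_half_plane" for z
  proof -
    have "(cmod (z - 1 / 2))\<^sup>2 < (cmod (z + 1 / 2))\<^sup>2"
      using that unfolding cmod_power2 by (simp add: right_half_plane_def power2_eq_square algebra_simps)
    then have "cmod (z - 1 / 2) < cmod (z + 1 / 2)"
      by (rule power_less_imp_less_base) simp
    then show ?thesis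
      using nz[OF that] by (simp add: \<phi>_def norm_divide)
  qed
  \<comment> \<open>Conjugating the adjoint equation for \<open>r k\<close> gives a row equation. As
    \<open>\<tau>\<close> is \<open>cnj (p k)\<close> here, its output state is
    \<open>(p k + 1 / 2) * g k s\<close>, and \<open>\<phi> (p k)\<close> times this is the input
    state.\<close>
  have left: "left_node U n (\<phi> (p k)) (\<lambda>s. (p k + 1 / 2) * g k s) (cnj_vec (e k)) (cnj_vec (f k))"
    if k: "k < n" "k \<in> L" for k
  proof -
    have \<phi>p: "\<phi> (p k) * ((p k + 1 / 2) * x) = (p k - 1 / 2) * x" for x
      using nz[OF p[OF k(1)]] by (simp add: \<phi>_def)
    have U: "cnj (d k i) = (\<Sum>s<n. (p k - 1 / 2) * g k s * U (Inl s) i) + (\<Sum>j\<in>UNIV. cnj_vec (e k) $ j * U (Inr j) i)"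
      if "i \<in> ?I" for i
      unfolding Ur[OF k(1) that, symmetric] matvec_on_def sum_Plus_UNIV
      by (simp add: adj_mat_def r_def \<tau>_def k cnj_vec_def mult_ac)
    show ?thesis
      unfolding left_node_def \<phi>p using U[of "Inl _"] U[of "Inr _"]
      by (simp add: d_def \<tau>_def k cnj_vec_def InlI InrI)
  qed
  \<comment> \<open>Here \<open>\<tau>\<close> is \<open>- p k\<close>, so \<open>d k\<close>
    carries \<open>- p k + 1 / 2\<close> and \<open>r k\<close> carries
    \<open>- (p k + 1 / 2)\<close>: the latter is the state, the former is
    \<open>\<phi> (p k)\<close> times it.\<close>
  have right: "right_node U n (\<phi> (p k)) (\<lambda>s. - (p k + 1 / 2) * cnj (g k s)) (f k) (e k)"
    if k: "k < n" "k \<notin> L" for k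
  proof -
    have \<phi>p: "\<phi> (p k) * (- (p k + 1 / 2) * x) = (- p k + 1 / 2) * x" for x
    proof -
      have "\<phi> (p k) * (- (p k + 1 / 2) * x) = - (\<phi> (p k) * (p k + 1 / 2)) * x"
        by (simp only: mult_minus_left mult_minus_right mult.assoc)
      also have "\<phi> (p k) * (p k + 1 / 2) = p k - 1 / 2"
        using nz[OF p[OF k(1)]] by (simp add: \<phi>_def)
      finally show ?thesis
        by simp
    qed
    have U: "r k j = (\<Sum>t<n. U j (Inl t) * ((- p k + 1 / 2) * cnj (g k t))) + (\<Sum>i\<in>UNIV. U j (Inr i) * f k $ i)"
      if "j \<in> ?J" for j
      unfolding Ud[OF k(1) that, symmetric] matvec_on_def sum_Plus_UNIV
      by (simp add: d_def \<tau>_def k)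
    show ?thesis
      unfolding right_node_def \<phi>p using U[of "Inl _"] U[of "Inr _"]
      by (simp add: r_def \<tau>_def k InlI InrI)
  qed
  have S: "S \<in> schur_class"
  proof -
    have "(\<lambda>z. S z $ i $ j) holomorphic_on right_half_plane" for i j
    proof -
      have "((\<lambda>\<zeta>. T \<zeta> $ i $ j) \<circ> \<phi>) holomorphic_on right_half_plane"
        by (rule holomorphic_on_compose_gen[OF _ T_hol])
          (use \<phi> nz in \<open>auto simp: \<phi>_def[abs_def] intro!: holomorphic_intros\<close>)
      then show ?thesis
        by (simp add: S_def o_def)
    qed
    then show ?thesis
      using T_norm \<phi> by (auto simp: schur_class_def S_def)
  qed
  have deriv: "mat_deriv S z $ i $ j = mat_deriv T (\<phi> z) $ i $ j / (z + 1 / 2)\<^sup>2"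
    if z: "z \<in> right_half_plane" for z i j
  proof -
    have "((\<lambda>\<zeta>. T \<zeta> $ i $ j) has_field_derivative mat_deriv T (\<phi> z) $ i $ j) (at (\<phi> z))"
      using holomorphic_derivI[OF T_hol[of i j] open_ball, of "\<phi> z"] \<phi>[OF z] by (simp add: mat_deriv_def)
    moreover have "(\<phi> has_field_derivative 1 / (z + 1 / 2)\<^sup>2) (at z)"
    proof -
      have "(\<phi> has_field_derivative (1 * (z + 1 / 2) - (z - 1 / 2) * 1) / ((z + 1 / 2) * (z + 1 / 2))) (at z)"
        unfolding \<phi>_def using nz[OF z] by (intro DERIV_divide) (auto intro!: derivative_eq_intros)
      then show ?thesis
        by (simp add: power2_eq_square)
    qed
    ultimately have "((\<lambda>z. S z $ i $ j) has_field_derivative mat_deriv T (\<phi> z) $ i $ j * (1 / (z + 1 / 2)\<^sup>2)) (at z)"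
      unfolding S_def by (rule DERIV_chain2)
    then show ?thesis
      by (simp add: mat_deriv_def DERIV_imp_deriv)
  qed
  \<comment> \<open>The product of the two states is \<open>- (p k + 1 / 2)\<^sup>2 * P k l\<close>,
    and the chain rule factor of the Cayley transform cancels the square.\<close>
  have deriv_node: "herm (e k) (mat_deriv S (p k) *v f l) = - P k l"
    if kl: "k < n" "l < n" "k \<in> L" "l \<notin> L" "p k = p l" for k l
  proof -
    have "herm (e k) (mat_deriv T (\<phi> (p k)) *v f l) =
        (\<Sum>s<n. (p k + 1 / 2) * g k s * (- (p l + 1 / 2) * cnj (g l s)))"
      unfolding herm_def using kl right[of l]
      by (intro T_deriv[OF \<phi>[OF p] left]) auto
    also have "\<dots> = (\<Sum>s<n. - (p k + 1 / 2)\<^sup>2 * (g k s * cnj (g l s)))"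
      by (intro sum.cong refl) (simp add: kl(5) power2_eq_square algebra_simps)
    also have "\<dots> = - (p k + 1 / 2)\<^sup>2 * P k l"
      unfolding g[OF kl(1,2)] inner_on_def by (rule sum_distrib_left[symmetric])
    finally have T: "herm (e k) (mat_deriv T (\<phi> (p k)) *v f l) = - (p k + 1 / 2)\<^sup>2 * P k l" .
    have "herm (e k) (mat_deriv S (p k) *v f l) =
        herm (e k) (mat_deriv T (\<phi> (p k)) *v f l) / (p k + 1 / 2)\<^sup>2"
      by (simp add: herm_altdef matrix_vector_mult_def deriv[OF p[OF kl(1)]] sum_divide_distrib sum_distrib_left)
    then show ?thesis
      unfolding T using nz[OF p[OF kl(1)]] by simp
  qed
  show thesis
    by (rule that[OF S _ _ deriv_node])
      (auto simp: S_def intro: T_left[OF \<phi>[OF p] left] T_right[OF \<phi>[OF p] right])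
qed

section \<open>The Pick matrix\<close>

lemma positive_semidefinite_iff:
  assumes "A \<in> carrier_mat n n"
  shows "positive_semidefinite A \<longleftrightarrow>
    (\<forall>k<n. \<forall>l<n. A $$ (l, k) = cnj (A $$ (k, l))) \<and>
    (\<forall>c. 0 \<le> Re (\<Sum>k<n. \<Sum>l<n. cnj (c k) * A $$ (k, l) * c l))"
proof -
  have dims: "dim_row A = n" "dim_col A = n"
    using assms by auto
  have herm: "mat_adjoint A = A \<longleftrightarrow> (\<forall>k<n. \<forall>l<n. A $$ (l, k) = cnj (A $$ (k, l)))"
  proof -
    have adj_mat: "mat_adjoint A $$ (l, k) = cnj (A $$ (k, l))" if "k < n" "l < n" for k l
      using that by (simp add: mat_adjoint_def dims mat_of_rows_index)
    have "dim_row (mat_adjoint A) = n" "dim_col (mat_adjoint A) = n"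
      by (simp_all add: mat_adjoint_def dims)
    then show ?thesis
      using adj_mat by (metis (no_types, lifting) dims eq_matI)
  qed
  have form: "((A *\<^sub>v c) \<bullet>c c) =
      (\<Sum>k<n. \<Sum>l<n. cnj (Matrix.vec_index c k) * A $$ (k, l) * Matrix.vec_index c l)" if "c \<in> carrier_vec n" for c
    using that dims
    by (auto simp: scalar_prod_def lessThan_atLeast0 sum_distrib_right sum_distrib_left mult_ac intro!: sum.cong)
  have "(\<forall>c\<in>carrier_vec n. 0 \<le> Re ((A *\<^sub>v c) \<bullet>c c)) \<longleftrightarrow>
      (\<forall>c. 0 \<le> Re (\<Sum>k<n. \<Sum>l<n. cnj (c k) * A $$ (k, l) * c l))" (is "?L \<longleftrightarrow> ?R")
  proof
    assume L: ?L
    show ?R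
    proof
      fix c :: "nat \<Rightarrow> complex"
      have c: "Matrix.vec n c \<in> carrier_vec n"
        by simp
      have "0 \<le> Re ((A *\<^sub>v Matrix.vec n c) \<bullet>c Matrix.vec n c)"
        using L c by (rule bspec)
      also have "(A *\<^sub>v Matrix.vec n c) \<bullet>c Matrix.vec n c =
          (\<Sum>k<n. \<Sum>l<n. cnj (c k) * A $$ (k, l) * c l)"
        unfolding form[OF c] by simp
      finally show "0 \<le> Re (\<Sum>k<n. \<Sum>l<n. cnj (c k) * A $$ (k, l) * c l)" .
    qed
  next
    assume ?R
    then show ?L
      by (simp add: form del: Re_sum)
  qed
  then show ?thesis
    unfolding positive_semidefinite_def herm dims by (simp add: dims)
qed

lemma pick_matrix_carrier: "pick_matrix N N' z w x y u v \<rho> \<in> carrier_mat (N + N') (N + N')"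
  by (simp add: pick_matrix_def Let_def)

lemma cnj_vec_cnj_vec [simp]: "cnj_vec (cnj_vec x) = x"
  by (simp add: cnj_vec_def Finite_Cartesian_Product.vec_eq_iff)

lemma herm_minus_left: "herm (- x) y = - herm x y" and herm_minus_right: "herm x (- y) = - herm x y"
  by (simp_all add: herm_altdef sum_negf)

lemma matrix_vector_mult_minus: "(M :: complex ^ 'm ^ 'p) *v (- u) = - (M *v u)"
  by (simp add: matrix_vector_mult_def Finite_Cartesian_Product.vec_eq_iff sum_negf)

lemma scalar_product_eq_herm: "scalar_product x y = herm (cnj_vec x) y"
  by (simp add: herm_def)

lemma pick_matrix_entries:
  fixes N N' :: nat and z w :: "nat \<Rightarrow> complex" and x y u v \<rho>
  defines "A \<equiv> pick_matrix N N' z w x y u v \<rho>"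
  shows "i < N \<Longrightarrow> j < N \<Longrightarrow> A $$ (i, j) =
      (herm (cnj_vec (x i)) (cnj_vec (x j)) - herm (cnj_vec (y i)) (cnj_vec (y j))) / (z i + cnj (z j))"
    and "i < N \<Longrightarrow> N \<le> j \<Longrightarrow> j < N + N' \<Longrightarrow> A $$ (i, j) =
      (if z i \<noteq> w (j - N) then (herm (cnj_vec (x i)) (v (j - N)) - herm (cnj_vec (y i)) (u (j - N))) / (w (j - N) - z i)
       else \<rho> i (j - N))"
    and "N \<le> i \<Longrightarrow> i < N + N' \<Longrightarrow> j < N \<Longrightarrow> A $$ (i, j) = cnj (A $$ (j, i))"
    and "N \<le> i \<Longrightarrow> i < N + N' \<Longrightarrow> N \<le> j \<Longrightarrow> j < N + N' \<Longrightarrow> A $$ (i, j) =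
      (herm (u (i - N)) (u (j - N)) - herm (v (i - N)) (v (j - N))) / (cnj (w (i - N)) + w (j - N))"
  unfolding A_def pick_matrix_def Let_def scalar_product_eq_herm
  by (auto simp: mat_adjoint_def mat_of_rows_index)

theorem theorem1p1:
  fixes N N' :: nat
    and z w :: "nat \<Rightarrow> complex"
    and x :: "nat \<Rightarrow> complex ^ 'p"
    and y :: "nat \<Rightarrow> complex ^ 'm"
    and u :: "nat \<Rightarrow> complex ^ 'm"
    and v :: "nat \<Rightarrow> complex ^ 'p"
    and \<rho> :: "nat \<Rightarrow> nat \<Rightarrow> complex"
  assumes "\<And>i. i < N \<Longrightarrow> z i \<in> right_half_plane"
    and "\<And>j. j < N' \<Longrightarrow> w j \<in> right_half_plane"
    and "\<And>i j. i < N \<Longrightarrow> j < N' \<Longrightarrow> z i = w j \<Longrightarrow>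
           scalar_product (x i) (v j) = scalar_product (y i) (u j)"
  shows "(\<exists>S :: complex \<Rightarrow> complex ^ 'm ^ 'p. S \<in> schur_class \<and>
            (\<forall>i<N. x i v* S (z i) = y i) \<and>
            (\<forall>j<N'. S (w j) *v u j = v j) \<and>
            (\<forall>i<N. \<forall>j<N'. z i = w j \<longrightarrow> scalar_product (x i) (mat_deriv S (z i) *v u j) = \<rho> i j))
         \<longleftrightarrow> positive_semidefinite (pick_matrix N N' z w x y u v \<rho>)"
    (is "?lhs \<longleftrightarrow> _")
proof -
  define n where "n = N + N'"
  define A where "A = pick_matrix N N' z w x y u v \<rho>"
  define P where "P k l = A $$ (k, l)" for k l
  define L where "L = {..<N}"
  define p where "p k = (if k < N then z k else w (k - N))" for k
  \<comment> \<open>The minus signs on the right data make the mixed block obey the same Lyapunov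
    equation as the other blocks; the conditions \<open>S (w j) *v u j = v j\<close> are unaffected
    by them.\<close>
  define e where "e k = (if k < N then cnj_vec (x k) else - v (k - N))" for k
  define f where "f k = (if k < N then cnj_vec (y k) else - u (k - N))" for k
  note entries = pick_matrix_entries[where N = N and N' = N' and z = z and w = w and x = x and y = y
      and u = u and v = v and \<rho> = \<rho>, folded A_def]
  have psd: "positive_semidefinite A \<longleftrightarrow> (\<forall>k<n. \<forall>l<n. P l k = cnj (P k l)) \<and>
      (\<forall>c. 0 \<le> Re (\<Sum>k<n. \<Sum>l<n. cnj (c k) * P k l * c l))"
    unfolding P_def n_def by (rule positive_semidefinite_iff) (simp add: A_def pick_matrix_carrier)
  have p: "p k \<in> right_half_plane" if "k < n" for k
    using assms(1)[of k] assms(2)[of "k - N"] that by (auto simp: p_def n_def)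
  then have Re_p: "0 < Re (p k)" if "k < n" for k
    using that by (simp add: right_half_plane_def)
  have LL: "P k l = (herm (e k) (e l) - herm (f k) (f l)) / (p k + cnj (p l))"
    if "k < n" "l < n" "k \<in> L" "l \<in> L" for k l
    using that by (simp add: P_def L_def entries(1) e_def f_def p_def)
  have RR: "P k l = (herm (f k) (f l) - herm (e k) (e l)) / (cnj (p k) + p l)"
    if "k < n" "l < n" "k \<notin> L" "l \<notin> L" for k l
    using that by (simp add: P_def L_def n_def entries(4) e_def f_def p_def herm_minus_left herm_minus_right)
  have LR: "P k l = (if p k \<noteq> p l then (herm (f k) (f l) - herm (e k) (e l)) / (p l - p k) else \<rho> k (l - N))"
    if "k < n" "l < n" "k \<in> L" "l \<notin> L" for k l
    using that by (simp add: P_def L_def n_def entries(2) e_def f_def p_def herm_minus_right)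
  have RL: "P k l = cnj (P l k)" if "k < n" "l < n" "k \<notin> L" "l \<in> L" for k l
    using that unfolding P_def L_def n_def by (intro entries(3)) auto
  have P_herm: "P l k = cnj (P k l)" if kl: "k < n" "l < n" for k l
  proof -
    consider "k \<in> L" "l \<in> L" | "k \<in> L" "l \<notin> L" | "k \<notin> L" "l \<in> L" | "k \<notin> L" "l \<notin> L"
      by blast
    then show ?thesis
    proof cases
      case 1
      then show ?thesis
        using kl by (simp add: LL cnj_herm add.commute)
    next
      case 2
      then show ?thesis
        using kl RL[of l k] by simp
    next
      case 3
      then show ?thesis
        using kl RL[of k l] by simp
    next
      case 4
      then show ?thesis
        using kl by (simp add: RR cnj_herm add.commute)
    qed
  qed
  \<comment> \<open>The conditions are restated over the joint index \<open>k < n\<close>. Right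
    indices are shifted by \<open>N\<close>, and the truncated subtraction \<open>k - N\<close> is
    exact because \<open>k \<notin> L\<close> means \<open>N \<le> k\<close>.\<close>
  have "?lhs \<longleftrightarrow> (\<exists>S :: complex \<Rightarrow> complex ^ 'm ^ 'p. S \<in> schur_class \<and>
      (\<forall>k<n. k \<in> L \<longrightarrow> cnj_vec (e k) v* S (p k) = cnj_vec (f k)) \<and>
      (\<forall>k<n. k \<notin> L \<longrightarrow> S (p k) *v f k = e k) \<and>
      (\<forall>k<n. \<forall>l<n. k \<in> L \<and> l \<notin> L \<and> p k = p l \<longrightarrow> herm (e k) (mat_deriv S (p k) *v f l) = - P k l))"
  proof (intro ex_cong1 conj_cong refl)
    fix S :: "complex \<Rightarrow> complex ^ 'm ^ 'p"
    have right_split: "(\<forall>j<N'. Q j) \<longleftrightarrow> (\<forall>k<n. k \<notin> L \<longrightarrow> Q (k - N))" for Q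
    proof
      assume "\<forall>k<n. k \<notin> L \<longrightarrow> Q (k - N)"
      then have "Q (N + j - N)" if "j < N'" for j
        using that unfolding n_def L_def by (metis add_less_cancel_left lessThan_iff not_add_less1)
      then show "\<forall>j<N'. Q j"
        by simp
    qed (auto simp: n_def L_def)
    have left_split: "(\<forall>i<N. Q i) \<longleftrightarrow> (\<forall>k<n. k \<in> L \<longrightarrow> Q k)" for Q
      by (auto simp: n_def L_def)
    show "(\<forall>i<N. x i v* S (z i) = y i) \<longleftrightarrow>
        (\<forall>k<n. k \<in> L \<longrightarrow> cnj_vec (e k) v* S (p k) = cnj_vec (f k))"
      unfolding left_split by (auto simp: L_def e_def f_def p_def)
    show "(\<forall>j<N'. S (w j) *v u j = v j) \<longleftrightarrow> (\<forall>k<n. k \<notin> L \<longrightarrow> S (p k) *v f k = e k)"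
      unfolding right_split by (auto simp: L_def e_def f_def p_def matrix_vector_mult_minus)
    have "scalar_product (x k) (mat_deriv S (z k) *v u (l - N)) = \<rho> k (l - N) \<longleftrightarrow>
        herm (e k) (mat_deriv S (p k) *v f l) = - P k l"
      if "k < n" "l < n" "k \<in> L" "l \<notin> L" "p k = p l" for k l
      using that LR[OF that(1-4)]
      by (simp add: scalar_product_eq_herm L_def e_def f_def p_def matrix_vector_mult_minus herm_minus_right)
    moreover have "z k = w (l - N) \<longleftrightarrow> p k = p l" if "k \<in> L" "l \<notin> L" for k l
      using that by (simp add: p_def L_def)
    ultimately show "(\<forall>i<N. \<forall>j<N'. z i = w j \<longrightarrow> scalar_product (x i) (mat_deriv S (z i) *v u j) = \<rho> i j) \<longleftrightarrow>
        (\<forall>k<n. \<forall>l<n. k \<in> L \<and> l \<notin> L \<and> p k = p l \<longrightarrow> herm (e k) (mat_deriv S (p k) *v f l) = - P k l)"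
      unfolding left_split right_split by blast
  qed
  also have "\<dots> \<longleftrightarrow> (\<forall>c. 0 \<le> Re (\<Sum>k<n. \<Sum>l<n. cnj (c k) * P k l * c l))"
  proof (intro iffI allI)
    fix c
    assume "\<exists>S :: complex \<Rightarrow> complex ^ 'm ^ 'p. S \<in> schur_class \<and>
      (\<forall>k<n. k \<in> L \<longrightarrow> cnj_vec (e k) v* S (p k) = cnj_vec (f k)) \<and>
      (\<forall>k<n. k \<notin> L \<longrightarrow> S (p k) *v f k = e k) \<and>
      (\<forall>k<n. \<forall>l<n. k \<in> L \<and> l \<notin> L \<and> p k = p l \<longrightarrow> herm (e k) (mat_deriv S (p k) *v f l) = - P k l)"
    then obtain S :: "complex \<Rightarrow> complex ^ 'm ^ 'p" where S: "S \<in> schur_class"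
      and left: "\<And>k. k < n \<Longrightarrow> k \<in> L \<Longrightarrow> cnj_vec (e k) v* S (p k) = cnj_vec (f k)"
      and right: "\<And>k. k < n \<Longrightarrow> k \<notin> L \<Longrightarrow> S (p k) *v f k = e k"
      and deriv: "\<And>k l. k < n \<Longrightarrow> l < n \<Longrightarrow> k \<in> L \<Longrightarrow> l \<notin> L \<Longrightarrow> p k = p l \<Longrightarrow>
        herm (e k) (mat_deriv S (p k) *v f l) = - P k l"
      by blast
    \<comment> \<open>At distinct nodes the left condition gives the value at \<open>p k\<close> and
      the right condition the value at \<open>p l\<close>; at coinciding nodes the prescribed
      derivative is the confluent value.\<close>
    have "P k l = - divided_difference (\<lambda>z. herm (e k) (S z *v f l)) (p k) (p l)"
      if kl: "k < n" "l < n" "k \<in> L" "l \<notin> L" for k l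
    proof (cases "p k = p l")
      case True
      then show ?thesis
        using deriv[OF kl True]
          DERIV_imp_deriv[OF herm_matrix_has_field_derivative[OF S p[OF kl(1)]], of "e k" "f l"]
        by (simp add: divided_difference_def)
    next
      case False
      have "herm (e k) (S (p k) *v f l) = herm (f k) (f l)"
        unfolding herm_def scalar_product_matrix_assoc[symmetric] left[OF kl(1,3)] ..
      moreover have "herm (e k) (S (p l) *v f l) = herm (e k) (e l)"
        unfolding right[OF kl(2,4)] ..
      ultimately show ?thesis
        using False by (simp add: LR[OF kl] divided_difference_def minus_divide_left)
    qed
    then show "0 \<le> Re (\<Sum>k<n. \<Sum>l<n. cnj (c k) * P k l * c l)"
      using pick_form_nonneg_half_plane[of S n p L e f P, OF S p left right LL RR _ RL] by blast
  next
    assume nonneg: "\<forall>c. 0 \<le> Re (\<Sum>k<n. \<Sum>l<n. cnj (c k) * P k l * c l)"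
    have lyapunov: "(cnj (if k \<in> L then cnj (p k) else - p k) + (if l \<in> L then cnj (p l) else - p l)) * P k l =
        herm (e k) (e l) - herm (f k) (f l)" if kl: "k < n" "l < n" for k l
    proof -
      have nz: "p k + cnj (p l) \<noteq> 0" "cnj (p k) + p l \<noteq> 0"
        using Re_p[OF kl(1)] Re_p[OF kl(2)] by (auto simp: complex_eq_iff)
      have mixed: "(p k - p l) * P k l = herm (e k) (e l) - herm (f k) (f l)"
        if "k < n" "l < n" "k \<in> L" "l \<notin> L" for k l
      proof (cases "p k = p l")
        \<comment> \<open>The left side is 0 whatever \<open>\<rho>\<close> is, so the right side
          must vanish too; this is the compatibility \<open>x v = y u\<close> assumed at coinciding
          nodes.\<close>
        case True
        then have "herm (e k) (e l) = herm (f k) (f l)"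
          using assms(3)[of k "l - N"] that
          by (simp add: L_def n_def p_def e_def f_def scalar_product_eq_herm herm_minus_right)
        then show ?thesis
          using True by simp
      next
        case False
        then show ?thesis
          by (simp add: LR[OF that] field_simps)
      qed
      consider "k \<in> L" "l \<in> L" | "k \<in> L" "l \<notin> L" | "k \<notin> L" "l \<in> L" | "k \<notin> L" "l \<notin> L"
        by blast
      then show ?thesis
      proof cases
        case 1
        then show ?thesis
          using nz kl by (simp add: LL)
      next
        case 2
        then show ?thesis
          using mixed kl by simp
      next
        case 3
        have "cnj ((p l - p k) * P l k) = cnj (herm (e l) (e k) - herm (f l) (f k))"
          using mixed[of l k] kl 3 by simp
        then show ?thesis
          using kl 3 by (simp add: RL cnj_herm)
      next
        case 4
        have "(cnj (- p k) + - p l) * P k l = - ((cnj (p k) + p l) * P k l)"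
          by (simp add: algebra_simps)
        also have "(cnj (p k) + p l) * P k l = herm (f k) (f l) - herm (e k) (e l)"
          using nz kl 4 by (simp add: RR)
        finally show ?thesis
          using 4 by simp
      qed
    qed
    show "\<exists>S :: complex \<Rightarrow> complex ^ 'm ^ 'p. S \<in> schur_class \<and>
      (\<forall>k<n. k \<in> L \<longrightarrow> cnj_vec (e k) v* S (p k) = cnj_vec (f k)) \<and>
      (\<forall>k<n. k \<notin> L \<longrightarrow> S (p k) *v f k = e k) \<and>
      (\<forall>k<n. \<forall>l<n. k \<in> L \<and> l \<notin> L \<and> p k = p l \<longrightarrow> herm (e k) (mat_deriv S (p k) *v f l) = - P k l)"
      by (rule half_plane_interpolant[of n p L P e f, OF p lyapunov P_herm nonneg[rule_format]]) blast+
  qed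
  \<comment> \<open>The Pick matrix is Hermitian by construction, so semidefiniteness reduces to
    nonnegativity of the form.\<close>
  also have "\<dots> \<longleftrightarrow> positive_semidefinite A"
    unfolding psd using P_herm by blast
  finally show ?thesis
    unfolding A_def .
qed

end
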